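(* Let $s$ be a positive integer and let $\mathfrak{k}$ be a compact simple Lie superalgebra with $\mathfrak{k}_1\neq\{0\}$. Suppose $\widehat{\mathfrak{g}}=\mathfrak{g}\oplus M$ is a perfect central extension of $\mathfrak{g}=\Lambda_s(\mathbb{R})\otimes\mathfrak{k}$ such that $\operatorname{urad}(\widehat{\mathfrak{g}})$ is a proper ideal. Then $$\operatorname{urad}(\widehat{\mathfrak{g}})=(\Lambda_s^+(\mathbb{R})\otimes\mathfrak{k})\oplus(M\cap\operatorname{urad}(\widehat{\mathfrak{g}})).$$ In particular, either all unitary representations of $\widehat{\mathfrak{g}}$ are trivial, or they factor through a central extension of $\mathfrak{k}$.
   Context: All Lie superalgebras are finite dimensional and real. A Lie superalgebra $\mathfrak{k}=\mathfrak{k}_0\oplus\mathfrak{k}_1$ is compact if the subgroup of $\operatorname{Aut}(\mathfrak{k})$ generated by $e^{\operatorname{ad}(\mathfrak{k}_0)}$ has compact closure; it is perfect if $[\mathfrak{k},\mathfrak{k}]=\mathfrak{k}$. $\Lambda_s(\mathbb{R})$ is the real Grassmann superalgebra on odd generators $\epsilon_1,\ldots,\epsilon_s$ ($\epsilon_i\epsilon_j+\epsilon_j\epsilon_i=0$), and $\Lambda_s^+(\mathbb{R})$ is the span of all products of $m\geq1$ generators. The bracket on $\Lambda_s(\mathbb{R})\otimes\mathfrak{k}$ is $[a\otimes x,b\otimes y]=(-1)^{|x||b|}ab\otimes[x,y]$. A central extension $\widehat{\mathfrak{g}}=\mathfrak{g}\oplus M$ of $\mathfrak{g}$ by a superspace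 $M$ is the Lie superalgebra with bracket $[X+m,X'+m']_\omega=[X,X']+\omega(X,X')$, where $\omega\colon\mathfrak{g}\times\mathfrak{g}\to M$ is a 2-cocycle, i.e., a bilinear map with $\omega(x,y)=-(-1)^{|x||y|}\omega(y,x)$ and $\omega([x,y],z)=\omega(x,[y,z])-(-1)^{|x||y|}\omega(y,[x,z])$. For a Lie superalgebra $\mathfrak{h}$, $\mathscr{C}(\mathfrak{h})\subseteq\mathfrak{h}_0$ is the closed convex cone generated by the brackets $[x,x]$, $x\in\mathfrak{h}_1$; with $\mathfrak{E}:=\mathscr{C}(\mathfrak{h})\cap-\mathscr{C}(\mathfrak{h})$, the unitary radical $\operatorname{urad}(\mathfrak{h})$ is the ideal of $\mathfrak{h}$ generated by $\mathfrak{E}$ and all $x\in\mathfrak{h}_1$ with $[x,x]\in\mathfrak{E}$. A pre-Hilbert superspace is a complex $\mathscr{H}=\mathscr{H}_0\oplus\mathscr{H}_1$ with an inner product (linear in the first argument) such that $\langle\mathscr{H}_0,\mathscr{H}_1\rangle=\{0\}$. A unitary representation of $\mathfrak{h}$ in $\mathscr{H}$ is a homomorphism of real Lie superalgebras $\chi\colon\mathfrak{h}\to\operatorname{End}(\mathscr{H})$ with $\langle\chi(X)u,v\rangle=\langle u,-i^{|X|}\chi(X)v\rangle$ for homogeneous $X\in\mathfrak{h}$, $u,v\in\mathscr{H}$.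
   Formalization: For an arbitrary cocycle ω the displayed identity can fail (change ω by a coboundary); it is proved with Λ_s^+⊗k embedded by some even linear section of the projection from ĝ onto g, i.e. after replacing ω by a cohomologous cocycle. *)

theory Defs
  imports
    "HOL-Analysis.Analysis"
    "HOL-Algebra.Bij"
    "HOL-Algebra.Generated_Groups"
begin

section \<open>Superspaces and Lie superalgebras\<close>

text \<open>
  A finite dimensional real superspace is given by two subspaces of an ambient Euclidean space
  (which supplies finite dimensionality and the topology); it may be zero. Degrees are natural
  numbers read modulo 2, so that signs can be written \<open>(-1) ^ (p * q)\<close>. Maps are only
  constrained on \<open>vecs V\<close>, the underlying space.
\<close>

record 'a superspace =
  even_part :: "'a set"
  odd_part :: "'a set"

record 'a superalgebra = "'a superspace" +
  brkt :: "'a \<Rightarrow> 'a \<Rightarrow> 'a"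

definition homog :: "('a, 'z) superspace_scheme \<Rightarrow> nat \<Rightarrow> 'a set" where
  "homog V p = (if even p then even_part V else odd_part V)"

definition vecs :: "('a::plus, 'z) superspace_scheme \<Rightarrow> 'a set" where
  "vecs V = {x + y |x y. x \<in> even_part V \<and> y \<in> odd_part V}"

definition superspace :: "('a::euclidean_space, 'z) superspace_scheme \<Rightarrow> bool" where
  "superspace V \<longleftrightarrow>
     subspace (even_part V) \<and> subspace (odd_part V) \<and> even_part V \<inter> odd_part V = {0}"

definition component :: "('a::euclidean_space, 'z) superspace_scheme \<Rightarrow> nat \<Rightarrow> 'a \<Rightarrow> 'a" where
  "component V p x = (THE y. y \<in> homog V p \<and> x - y \<in> homog V (p + 1))"

definition linear_on :: "'a::real_vector set \<Rightarrow> ('a \<Rightarrow> 'b::real_vector) \<Rightarrow> bool" where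
  "linear_on A f \<longleftrightarrow>
     (\<forall>x\<in>A. \<forall>y\<in>A. \<forall>a b. f (a *\<^sub>R x + b *\<^sub>R y) = a *\<^sub>R f x + b *\<^sub>R f y)"

text \<open>Even linear maps between superspaces.\<close>
definition even_linear ::
  "('a::euclidean_space, 'y) superspace_scheme \<Rightarrow> ('b::euclidean_space, 'z) superspace_scheme
    \<Rightarrow> ('a \<Rightarrow> 'b) \<Rightarrow> bool" where
  "even_linear V W f \<longleftrightarrow>
     linear_on (vecs V) f \<and> (\<forall>p. \<forall>x\<in>homog V p. f x \<in> homog W p)"

text \<open>Even super skew-symmetric bilinear maps from \<open>V \<times> V\<close> to \<open>W\<close>.\<close>
definition super_skew ::
  "('a::euclidean_space, 'y) superspace_scheme \<Rightarrow> ('b::euclidean_space, 'z) superspace_scheme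
    \<Rightarrow> ('a \<Rightarrow> 'a \<Rightarrow> 'b) \<Rightarrow> bool" where
  "super_skew V W f \<longleftrightarrow>
     (\<forall>x\<in>vecs V. linear_on (vecs V) (f x)) \<and>
     (\<forall>y\<in>vecs V. linear_on (vecs V) (\<lambda>x. f x y)) \<and>
     (\<forall>p q. \<forall>x\<in>homog V p. \<forall>y\<in>homog V q.
        f x y \<in> homog W (p + q) \<and> f x y = - ((-1) ^ (p * q) *\<^sub>R f y x))"

definition lie_superalgebra :: "'a::euclidean_space superalgebra \<Rightarrow> bool" where
  "lie_superalgebra L \<longleftrightarrow>
     superspace L \<and> super_skew L L (brkt L) \<and>
     (\<forall>p q. \<forall>x\<in>homog L p. \<forall>y\<in>homog L q. \<forall>z\<in>vecs L.
        brkt L (brkt L x y) z =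
          brkt L x (brkt L y z) - (-1) ^ (p * q) *\<^sub>R brkt L y (brkt L x z))"

definition lsa_hom ::
  "'a::euclidean_space superalgebra \<Rightarrow> 'b::euclidean_space superalgebra \<Rightarrow> ('a \<Rightarrow> 'b) \<Rightarrow> bool" where
  "lsa_hom L L' f \<longleftrightarrow>
     even_linear L L' f \<and> (\<forall>x\<in>vecs L. \<forall>y\<in>vecs L. f (brkt L x y) = brkt L' (f x) (f y))"

text \<open>Ideals are graded.\<close>
definition lsa_ideal :: "'a::euclidean_space superalgebra \<Rightarrow> 'a set \<Rightarrow> bool" where
  "lsa_ideal L I \<longleftrightarrow>
     subspace I \<and> I = {x + y |x y. x \<in> I \<inter> even_part L \<and> y \<in> I \<inter> odd_part L} \<and>
     (\<forall>x\<in>vecs L. \<forall>y\<in>I. brkt L x y \<in> I)"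

definition simple_lsa :: "'a::euclidean_space superalgebra \<Rightarrow> bool" where
  "simple_lsa L \<longleftrightarrow>
     (\<exists>x\<in>vecs L. \<exists>y\<in>vecs L. brkt L x y \<noteq> 0) \<and>
     (\<forall>I. lsa_ideal L I \<longrightarrow> I = {0} \<or> I = vecs L)"

definition perfect_lsa :: "'a::euclidean_space superalgebra \<Rightarrow> bool" where
  "perfect_lsa L \<longleftrightarrow> span {brkt L x y |x y. x \<in> vecs L \<and> y \<in> vecs L} = vecs L"

section \<open>Compactness\<close>

text \<open>
  Automorphisms are taken extensional (\<open>undefined\<close> off \<open>vecs L\<close>), as elements of
  \<open>BijGroup\<close>. The product topology of \<^typ>\<open>'a \<Rightarrow> 'a\<close>, i.e. pointwise convergence,
  induces on them the usual topology, the space being finite dimensional.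
\<close>

definition lsa_aut :: "'a::euclidean_space superalgebra \<Rightarrow> ('a \<Rightarrow> 'a) set" where
  "lsa_aut L = {f \<in> Bij (vecs L). lsa_hom L L f}"

definition exp_ad :: "'a::euclidean_space superalgebra \<Rightarrow> 'a \<Rightarrow> 'a \<Rightarrow> 'a" where
  "exp_ad L x = (\<lambda>y\<in>vecs L. \<Sum>n. (1 / fact n) *\<^sub>R (brkt L x ^^ n) y)"

definition compact_lsa :: "'a::euclidean_space superalgebra \<Rightarrow> bool" where
  "compact_lsa L \<longleftrightarrow>
     compact (lsa_aut L \<inter> closure (generate (BijGroup (vecs L)) (exp_ad L ` even_part L)))"

section \<open>Grassmann superalgebras and current Lie superalgebras\<close>

text \<open>
  For a finite linearly ordered type \<open>'s\<close> of \<open>s = CARD('s)\<close> elements, \<^typ>\<open>real ^ 's set\<close> is the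
  Grassmann superalgebra on \<open>s\<close> generators: the coordinate at \<open>I\<close> belongs to the product of the
  generators with index in \<open>I\<close> taken in increasing order, \<open>blade I\<close>. Likewise
  \<^typ>\<open>'k ^ 's set\<close> is the tensor product of \<^typ>\<open>real ^ 's set\<close> with \<^typ>\<open>'k\<close>.
\<close>

definition blade :: "'s::finite set \<Rightarrow> real ^ 's set" where
  "blade I = axis I 1"

definition gsign :: "'s::{finite,linorder} set \<Rightarrow> 's set \<Rightarrow> real" where
  "gsign I J = (if I \<inter> J = {} then (-1) ^ card {(i, j). i \<in> I \<and> j \<in> J \<and> j < i} else 0)"

definition gmult ::
  "real ^ ('s::{finite,linorder} set) \<Rightarrow> real ^ 's set \<Rightarrow> real ^ 's set" where
  "gmult a b = (\<Sum>I\<in>UNIV. \<Sum>J\<in>UNIV. (a $ I * b $ J * gsign I J) *\<^sub>R blade (I \<union> J))"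

definition tensor :: "real ^ ('s::finite set) \<Rightarrow> 'k::euclidean_space \<Rightarrow> 'k ^ 's set" where
  "tensor a x = (\<chi> I. (a $ I) *\<^sub>R x)"

text \<open>
  The bracket expands both arguments into tensors \<open>blade I \<otimes> x\<close> with homogeneous \<open>x\<close> and applies
  the defining formula of the bracket of the tensor product to each term; see
  \<open>current_brkt_tensor\<close> below.
\<close>

definition current_brkt ::
  "'k::euclidean_space superalgebra \<Rightarrow> 'k ^ ('s::{finite,linorder} set) \<Rightarrow> 'k ^ 's set
    \<Rightarrow> 'k ^ 's set" where
  "current_brkt L X Y =
     (\<Sum>I\<in>UNIV. \<Sum>J\<in>UNIV. \<Sum>p<2.
        (-1) ^ (p * card J) *\<^sub>R
          tensor (gmult (blade I) (blade J)) (brkt L (component L p (X $ I)) (Y $ J)))"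

definition current ::
  "'k::euclidean_space superalgebra \<Rightarrow> ('k ^ ('s::{finite,linorder} set)) superalgebra" where
  "current L =
     \<lparr>even_part = {X. \<forall>I. X $ I \<in> homog L (card I)},
      odd_part = {X. \<forall>I. X $ I \<in> homog L (card I + 1)},
      brkt = current_brkt L\<rparr>"

definition current_plus ::
  "'k::euclidean_space superalgebra \<Rightarrow> ('k ^ ('s::{finite,linorder} set)) set" where
  "current_plus L = {X \<in> vecs (current L). X $ {} = 0}"

lemma gmult_blade: "gmult (blade I) (blade J) = gsign I J *\<^sub>R blade (I \<union> J)"
proof -
  have "gmult (blade I) (blade J) =
      (\<Sum>I'\<in>UNIV. if I' = I then \<Sum>J'\<in>UNIV. if J' = J then gsign I' J' *\<^sub>R blade (I' \<union> J') else 0 else 0)"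
    unfolding gmult_def
  proof (intro sum.cong refl)
    fix I'
    have b: "blade A $ B = (if B = A then 1 else 0)" for A B :: "'a set"
      by (simp add: blade_def axis_def)
    show "(\<Sum>J'\<in>UNIV. (blade I $ I' * blade J $ J' * gsign I' J') *\<^sub>R blade (I' \<union> J')) =
      (if I' = I then \<Sum>J'\<in>UNIV. if J' = J then gsign I' J' *\<^sub>R blade (I' \<union> J') else 0 else 0)"
      unfolding b
      by (simp add: if_distrib[of "\<lambda>c. c * _"] if_distrib[of "\<lambda>c. c *\<^sub>R _"] cong: if_cong)
  qed
  then show ?thesis by simp
qed

lemma gsign_generators:
  "gsign {i} {j} = (if i = j then 0 else if j < i then - 1 else 1)"
proof -
  have "{(i', j'). i' \<in> {i} \<and> j' \<in> {j} \<and> j' < i'} = (if j < i then {(i, j)} else {})"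
    by auto
  then show ?thesis by (simp add: gsign_def)
qed

lemma generators_anticommute:
  "gmult (blade {i}) (blade {j}) + gmult (blade {j}) (blade {i}) = 0"
proof -
  have "gsign {i} {j} + gsign {j} {i} = 0"
    unfolding gsign_generators by (cases i j rule: linorder_cases) (auto dest: less_asym)
  moreover have "{j} \<union> {i} = {i} \<union> {j}"
    by (rule Un_commute)
  ultimately show ?thesis
    unfolding gmult_blade by (metis scaleR_add_left scaleR_zero_left)
qed

lemma component_homog:
  assumes "superspace V" "x \<in> homog V p"
  shows "component V q x = (if even p = even q then x else 0)"
proof -
  have s: "subspace (homog V r)" for r
    using assms(1) by (auto simp: superspace_def homog_def)
  have i: "homog V r \<inter> homog V (r + 1) = {0}" for r
    using assms(1) by (auto simp: superspace_def homog_def)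
  have h: "homog V r = homog V t" if "even r = even t" for r t
    using that by (simp add: homog_def)
  show ?thesis
    unfolding component_def
  proof (rule the_equality)
    show "(if even p = even q then x else 0) \<in> homog V q \<and>
        x - (if even p = even q then x else 0) \<in> homog V (q + 1)"
      using assms(2) h[of p q] h[of p "q + 1"] s subspace_0 by auto
  next
    fix y assume y: "y \<in> homog V q \<and> x - y \<in> homog V (q + 1)"
    show "y = (if even p = even q then x else 0)"
    proof (cases "even p = even q")
      case True
      then have "x - y \<in> homog V q" using y assms(2) h[of p q] s subspace_diff by blast
      then have "x - y \<in> homog V q \<inter> homog V (q + 1)" using y by blast
      then show ?thesis unfolding i using True by simp
    next
      case False
      then have "x \<in> homog V (q + 1)" using assms(2) h[of p "q + 1"] by auto
      then have "x - (x - y) \<in> homog V (q + 1)" using y s subspace_diff by blast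
      then have "y \<in> homog V q \<inter> homog V (q + 1)" using y by simp
      then show ?thesis unfolding i using False by simp
    qed
  qed
qed

lemma homog_vecs:
  assumes "superspace V"
  shows "homog V p \<subseteq> vecs V"
proof
  fix x assume x: "x \<in> homog V p"
  have "0 \<in> even_part V" "0 \<in> odd_part V"
    using assms subspace_0 by (auto simp: superspace_def)
  moreover have "x = x + 0" "x = 0 + x" by simp_all
  ultimately show "x \<in> vecs V"
    using x unfolding homog_def vecs_def by (metis (mono_tags, lifting) mem_Collect_eq)
qed

lemma current_brkt_tensor:
  fixes a b :: "real ^ ('s::{finite,linorder} set)"
  assumes L: "lie_superalgebra L" and x: "x \<in> homog L p" and y: "y \<in> vecs L"
    and b: "\<And>J. b $ J \<noteq> 0 \<Longrightarrow> even (card J) = even q"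
  shows "current_brkt L (tensor a x) (tensor b y) =
           (-1) ^ (p * q) *\<^sub>R tensor (gmult a b) (brkt L x y)"
proof -
  have ss: "superspace L" and sk: "super_skew L L (brkt L)"
    using L by (auto simp: lie_superalgebra_def)
  have xv: "x \<in> vecs L" using x homog_vecs[OF ss] by auto
  have lin: "linear_on (vecs L) (brkt L x)" "z \<in> vecs L \<Longrightarrow> linear_on (vecs L) (\<lambda>x. brkt L x z)" for z
    using sk xv unfolding super_skew_def by blast+
  have l1: "brkt L x (c *\<^sub>R y) = c *\<^sub>R brkt L x y" for c
    using lin(1)[unfolded linear_on_def, rule_format, OF y y, of c 0] by simp
  have l2: "brkt L (c *\<^sub>R x) z = c *\<^sub>R brkt L x z" if "z \<in> vecs L" for c z
    using lin(2)[OF that, unfolded linear_on_def, rule_format, OF xv xv, of c 0] by simp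
  have l0: "brkt L 0 z = 0" if "z \<in> vecs L" for z
    using l2[OF that, of 0] by simp
  have yv: "c *\<^sub>R y \<in> vecs L" for c
  proof -
    obtain u v where "y = u + v" "u \<in> even_part L" "v \<in> odd_part L"
      using y by (auto simp: vecs_def)
    then have "c *\<^sub>R y = c *\<^sub>R u + c *\<^sub>R v" "c *\<^sub>R u \<in> even_part L" "c *\<^sub>R v \<in> odd_part L"
      using ss by (auto simp: superspace_def scaleR_add_right subspace_scale)
    then show ?thesis unfolding vecs_def by blast
  qed
  have cx: "component L r (c *\<^sub>R x) = (if even p = even r then c *\<^sub>R x else 0)" for r c
    by (rule component_homog[OF ss])
      (use x ss in \<open>auto simp: superspace_def homog_def intro: subspace_scale split: if_splits\<close>)
  have bil: "brkt L (c *\<^sub>R x) (d *\<^sub>R y) = (c * d) *\<^sub>R brkt L x y" for c d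
    using l2[OF yv] l1 by simp
  have t: "tensor (c *\<^sub>R u) z = c *\<^sub>R tensor u z" "tensor u (c *\<^sub>R z) = c *\<^sub>R tensor u z"
    for c and u :: "real ^ 's set" and z :: 'a
    by (simp_all add: tensor_def vec_eq_iff mult.commute)
  have ts: "tensor (\<Sum>i\<in>A. f i) z = (\<Sum>i\<in>A. tensor (f i) z)"
    for A :: "'s set set" and f :: "'s set \<Rightarrow> real ^ 's set" and z :: 'a
    by (simp add: tensor_def vec_eq_iff scaleR_sum_left)
  have "(\<Sum>r<2. (-1) ^ (r * card J) *\<^sub>R tensor (gmult (blade I) (blade J))
          (brkt L (component L r (tensor a x $ I)) (tensor b y $ J)))
      = (-1) ^ (p * q) *\<^sub>R tensor ((a $ I * b $ J * gsign I J) *\<^sub>R blade (I \<union> J)) (brkt L x y)"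
    (is "?l = ?r") for I J
  proof (cases "b $ J = 0")
    case True
    have "brkt L z 0 = 0" if "z = c *\<^sub>R x \<or> z = 0" for z c
      using that bil[of c 0] bil[of 0 0] by auto
    then show ?thesis
      using True by (auto simp: tensor_def cx vec_eq_iff numeral_2_eq_2)
  next
    case False
    have sg: "(-1::real) ^ (p * card J) = (-1) ^ (p * q)"
      using b[OF False] by (simp add: minus_one_power_iff)
    have sg': "(-1::real) ^ (r * card J) = (-1) ^ (p * card J)" if "even p = even r" for r
      using that by (simp add: minus_one_power_iff)
    have "?l = (\<Sum>r<2::nat. if even p = even r then ?r else 0)"
    proof (rule sum.cong[OF refl])
      fix r :: nat
      show "(-1) ^ (r * card J) *\<^sub>R tensor (gmult (blade I) (blade J))
              (brkt L (component L r (tensor a x $ I)) (tensor b y $ J)) =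
            (if even p = even r then ?r else 0)"
      proof (cases "even p = even r")
        case True
        then have "component L r (tensor a x $ I) = a $ I *\<^sub>R x"
          using cx by (simp add: tensor_def)
        then show ?thesis
          using True sg sg'[OF True]
          by (simp add: tensor_def[of b] bil gmult_blade t mult_ac)
      next
        case False
        then have "component L r (tensor a x $ I) = 0"
          using cx by (simp add: tensor_def)
        then show ?thesis
          using False by (simp add: tensor_def[of b] l0[OF yv]) (simp add: tensor_def vec_eq_iff)
      qed
    qed
    also have "\<dots> = ?r" by (simp add: numeral_2_eq_2)
    finally show ?thesis .
  qed
  then show ?thesis
    by (simp add: current_brkt_def gmult_def ts scaleR_sum_right)
qed

section \<open>Central extensions\<close>

text \<open>
  The cocycle is even: this is what makes the bracket of the central extension compatible with the
  grading.
\<close>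
definition two_cocycle ::
  "'a::euclidean_space superalgebra \<Rightarrow> 'm::euclidean_space superspace \<Rightarrow> ('a \<Rightarrow> 'a \<Rightarrow> 'm) \<Rightarrow> bool" where
  "two_cocycle L M \<omega> \<longleftrightarrow>
     super_skew L M \<omega> \<and>
     (\<forall>p q. \<forall>x\<in>homog L p. \<forall>y\<in>homog L q. \<forall>z\<in>vecs L.
        \<omega> (brkt L x y) z = \<omega> x (brkt L y z) - (-1) ^ (p * q) *\<^sub>R \<omega> y (brkt L x z))"

definition central_ext ::
  "'a::euclidean_space superalgebra \<Rightarrow> 'm::euclidean_space superspace \<Rightarrow> ('a \<Rightarrow> 'a \<Rightarrow> 'm)
    \<Rightarrow> ('a \<times> 'm) superalgebra" where
  "central_ext L M \<omega> =
     \<lparr>even_part = even_part L \<times> even_part M,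
      odd_part = odd_part L \<times> odd_part M,
      brkt = (\<lambda>(x, m) (x', m'). (brkt L x x', \<omega> x x'))\<rparr>"

definition central_part :: "'m::euclidean_space superspace \<Rightarrow> ('a::euclidean_space \<times> 'm) set" where
  "central_part M = {0} \<times> vecs M"

text \<open>
  Even linear sections of the projection of a central extension onto \<open>L\<close>, that is, the ways of
  identifying \<open>L\<close> with a graded complement of \<open>central_part M\<close>. None of them is canonical:
  \<open>\<sigma> x = (x, \<theta> x)\<close> identifies the central extension by \<open>\<omega>\<close> with the one by the cohomologous
  cocycle \<open>\<lambda>x y. \<omega> x y - \<theta> (brkt L x y)\<close>. A subspace of \<open>L\<close> is therefore a subspace of the
  central extension only relative to a section, and statements about such subspaces depend on its
  choice.
\<close>
definition ext_section ::
  "'a::euclidean_space superalgebra \<Rightarrow> 'm::euclidean_space superspace \<Rightarrow> ('a \<Rightarrow> 'a \<Rightarrow> 'm)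
    \<Rightarrow> ('a \<Rightarrow> 'a \<times> 'm) \<Rightarrow> bool" where
  "ext_section L M \<omega> \<sigma> \<longleftrightarrow>
     even_linear L (central_ext L M \<omega>) \<sigma> \<and> (\<forall>x\<in>vecs L. fst (\<sigma> x) = x)"

section \<open>The unitary radical\<close>

definition sq_cone :: "'a::euclidean_space superalgebra \<Rightarrow> 'a set" where
  "sq_cone L =
     (\<lambda>C. closed C \<and> convex C \<and> cone C) hull ((\<lambda>x. brkt L x x) ` odd_part L)"

definition sq_cone_edge :: "'a::euclidean_space superalgebra \<Rightarrow> 'a set" where
  "sq_cone_edge L = sq_cone L \<inter> uminus ` sq_cone L"

definition urad :: "'a::euclidean_space superalgebra \<Rightarrow> 'a set" where
  "urad L = lsa_ideal L hull
     (sq_cone_edge L \<union> {x \<in> odd_part L. brkt L x x \<in> sq_cone_edge L})"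

definition is_direct_sum :: "'a::real_vector set \<Rightarrow> 'a set \<Rightarrow> 'a set \<Rightarrow> bool" where
  "is_direct_sum W U V \<longleftrightarrow> W = {u + v |u v. u \<in> U \<and> v \<in> V} \<and> U \<inter> V = {0}"

section \<open>Unitary representations\<close>

text \<open>
  The underlying space \<open>vecs H\<close> is a complex subspace of \<^typ>\<open>'h\<close>, of any dimension; operators are
  only constrained on \<open>vecs H\<close>.
\<close>
record 'h prehilbert = "'h superspace" +
  scaleH :: "complex \<Rightarrow> 'h \<Rightarrow> 'h"
  innerH :: "'h \<Rightarrow> 'h \<Rightarrow> complex"

definition prehilbert_superspace :: "'h::ab_group_add prehilbert \<Rightarrow> bool" where
  "prehilbert_superspace H \<longleftrightarrow>
     vector_space (scaleH H) \<and>
     module.subspace (scaleH H) (even_part H) \<and> module.subspace (scaleH H) (odd_part H) \<and>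
     even_part H \<inter> odd_part H = {0} \<and>
     (\<forall>u\<in>vecs H. \<forall>v\<in>vecs H. \<forall>w\<in>vecs H. \<forall>a b.
        innerH H (scaleH H a u + scaleH H b v) w = a * innerH H u w + b * innerH H v w) \<and>
     (\<forall>u\<in>vecs H. \<forall>v\<in>vecs H. innerH H v u = cnj (innerH H u v)) \<and>
     (\<forall>u\<in>vecs H. u \<noteq> 0 \<longrightarrow> Im (innerH H u u) = 0 \<and> Re (innerH H u u) > 0) \<and>
     (\<forall>u\<in>even_part H. \<forall>v\<in>odd_part H. innerH H u v = 0)"

definition unitary_rep ::
  "'a::euclidean_space superalgebra \<Rightarrow> 'h::ab_group_add prehilbert \<Rightarrow> ('a \<Rightarrow> 'h \<Rightarrow> 'h) \<Rightarrow> bool" where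
  "unitary_rep L H \<rho> \<longleftrightarrow>
     prehilbert_superspace H \<and>
     (\<forall>X\<in>vecs L. \<forall>u\<in>vecs H. \<forall>v\<in>vecs H. \<forall>a b.
        \<rho> X (scaleH H a u + scaleH H b v) = scaleH H a (\<rho> X u) + scaleH H b (\<rho> X v)) \<and>
     (\<forall>X\<in>vecs L. \<forall>Y\<in>vecs L. \<forall>v\<in>vecs H. \<forall>a b.
        \<rho> (a *\<^sub>R X + b *\<^sub>R Y) v =
          scaleH H (of_real a) (\<rho> X v) + scaleH H (of_real b) (\<rho> Y v)) \<and>
     (\<forall>p q. \<forall>X\<in>homog L p. \<forall>v\<in>homog H q. \<rho> X v \<in> homog H (p + q)) \<and>
     (\<forall>p q. \<forall>X\<in>homog L p. \<forall>Y\<in>homog L q. \<forall>v\<in>vecs H.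
        \<rho> (brkt L X Y) v = \<rho> X (\<rho> Y v) - scaleH H ((-1) ^ (p * q)) (\<rho> Y (\<rho> X v))) \<and>
     (\<forall>p<2. \<forall>X\<in>homog L p. \<forall>u\<in>vecs H. \<forall>v\<in>vecs H.
        innerH H (\<rho> X u) v = innerH H u (scaleH H (- (\<i> ^ p)) (\<rho> X v)))"

definition trivial_rep ::
  "'a::euclidean_space superalgebra \<Rightarrow> 'h::ab_group_add prehilbert \<Rightarrow> ('a \<Rightarrow> 'h \<Rightarrow> 'h) \<Rightarrow> bool" where
  "trivial_rep L H \<rho> \<longleftrightarrow> (\<forall>X\<in>vecs L. \<forall>v\<in>vecs H. \<rho> X v = 0)"

definition factors_via ::
  "'a::euclidean_space superalgebra \<Rightarrow> 'b::euclidean_space superalgebra \<Rightarrow> ('a \<Rightarrow> 'b)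
    \<Rightarrow> 'h::ab_group_add prehilbert \<Rightarrow> ('a \<Rightarrow> 'h \<Rightarrow> 'h) \<Rightarrow> bool" where
  "factors_via L Q \<pi> H \<rho> \<longleftrightarrow>
     (\<exists>\<rho>'. unitary_rep Q H \<rho>' \<and> (\<forall>X\<in>vecs L. \<forall>v\<in>vecs H. \<rho> X v = \<rho>' (\<pi> X) v))"

end

theory Submission
  imports Defs
begin

text \<open>
  Write \<open>U\<close> for the unitary radical of \<open>ghat\<close> and \<open>J\<close> for its image in the current algebra \<open>g\<close>. The
  core of the proof is the equality \<open>J = current_plus k\<close> when \<open>U\<close> is proper.

  The image is not too large. For an ideal of \<open>g\<close> and an index set \<open>I\<close>, the \<open>x\<close> with \<open>I \<otimes> x\<close> in the
  ideal form an ideal of \<open>k\<close>, hence \<open>0\<close> or \<open>k\<close>. If \<open>J\<close> were not contained in the nilpotent ideal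
  \<open>current_plus k\<close>, a descending induction on the degree would give \<open>J = g\<close>
  (\<open>ideal_with_head_full\<close>), and perfectness of \<open>ghat\<close> would give \<open>U = ghat\<close>.

  The image is not too small. It suffices to find \<open>\<epsilon> \<otimes> x\<close> in \<open>U\<close> for every generator \<open>\<epsilon>\<close> and every
  even \<open>x\<close> (\<open>generator_in_urad\<close>). This element is odd, and since \<open>\<epsilon>\<close> squares to zero its square in
  \<open>ghat\<close> is the central element \<open>\<omega> (\<epsilon> x) (\<epsilon> x)\<close>. As a function of the coefficients, \<open>\<omega>\<close> is here an
  invariant form on \<open>k\<close> with values in \<open>M\<close>. If the negative of the square were not in the cone, a
  separating functional would make the form real, positive semidefinite on \<open>even_part k\<close>
  and nonzero. No such form exists when \<open>k\<close> is simple with nonzero odd part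
  (\<open>semidefinite_invariant_form_zero\<close>): its radical is an ideal, and the Jacobi identity puts the
  squares \<open>[x, x]\<close> of odd elements into it, so that these would all be zero and the odd part would be
  an abelian ideal.

  The decomposition of \<open>U\<close> now amounts to a graded linear section of the projection \<open>U \<rightarrow> J\<close>. As for
  representations, positivity of \<open>-i \<rho>([x, x])\<close> for odd \<open>x\<close> forces every unitary representation to
  vanish on \<open>U\<close> (\<open>urad_subset_rep_kernel\<close>). If \<open>U = ghat\<close>, all of them are trivial; otherwise they
  factor through \<open>ghat / U\<close>, which is a central extension of \<open>g / J\<close>, that is, of \<open>k\<close>, by a
  complement of \<open>M \<inter> U\<close> in \<open>M\<close> (\<open>quotient_central_ext\<close>).
\<close>

section \<open>Linear algebra of superspaces\<close>

lemma homog_0: "homog V 0 = even_part V" and homog_1: "homog V 1 = odd_part V"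
  by (simp_all add: homog_def)

lemma homog_cong: "even p = even q \<Longrightarrow> homog V p = homog V q"
  by (simp add: homog_def)

lemma subspace_homog: "superspace V \<Longrightarrow> subspace (homog V p)"
  by (simp add: superspace_def homog_def)

lemma subspace_vecs: "superspace V \<Longrightarrow> subspace (vecs V)"
  unfolding superspace_def vecs_def by (auto intro: subspace_sums)

lemma vecsE:
  assumes "x \<in> vecs V"
  obtains x0 x1 where "x0 \<in> homog V 0" "x1 \<in> homog V 1" "x = x0 + x1"
  using assms by (auto simp: vecs_def homog_def)

lemma vecsI: "x0 \<in> homog V 0 \<Longrightarrow> x1 \<in> homog V 1 \<Longrightarrow> x0 + x1 \<in> vecs V"
  by (auto simp: vecs_def homog_def)

lemma homog_sum_eq_iff:
  assumes "superspace V" "a \<in> homog V 0" "a' \<in> homog V 0" "b \<in> homog V 1" "b' \<in> homog V 1"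
  shows "a + b = a' + b' \<longleftrightarrow> a = a' \<and> b = b'"
proof
  assume e: "a + b = a' + b'"
  then have "a - a' = b' - b" by (simp add: algebra_simps)
  moreover have "a - a' \<in> even_part V" "b' - b \<in> odd_part V"
    using assms subspace_homog[OF assms(1), of 0] subspace_homog[OF assms(1), of 1]
    by (auto simp: homog_def intro: subspace_diff)
  ultimately have "a - a' \<in> even_part V \<inter> odd_part V" by simp
  then have "a - a' = 0" using assms(1) unfolding superspace_def by blast
  then have "a = a'" by simp
  then show "a = a' \<and> b = b'" using e by simp
qed simp

lemma component_sum:
  assumes "superspace V" "x0 \<in> homog V 0" "x1 \<in> homog V 1"
  shows "component V p (x0 + x1) = (if even p then x0 else x1)"
  unfolding component_def
proof (rule the_equality)
  show "(if even p then x0 else x1) \<in> homog V p \<and>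
      x0 + x1 - (if even p then x0 else x1) \<in> homog V (p + 1)"
    using assms by (auto simp: homog_def)
next
  fix y assume y: "y \<in> homog V p \<and> x0 + x1 - y \<in> homog V (p + 1)"
  show "y = (if even p then x0 else x1)"
  proof (cases "even p")
    case True
    then have "y \<in> homog V 0" "x0 + x1 - y \<in> homog V 1" using y by (simp_all add: homog_def)
    moreover have "y + (x0 + x1 - y) = x0 + x1" by simp
    ultimately show ?thesis using homog_sum_eq_iff[OF assms(1)] assms True by metis
  next
    case False
    then have "y \<in> homog V 1" "x0 + x1 - y \<in> homog V 0" using y by (simp_all add: homog_def)
    moreover have "(x0 + x1 - y) + y = x0 + x1" by simp
    ultimately show ?thesis using homog_sum_eq_iff[OF assms(1)] assms False by metis
  qed
qed

lemma component_homog_in: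
  assumes "superspace V" "x \<in> vecs V"
  shows "component V p x \<in> homog V p"
proof -
  obtain x0 x1 where x: "x0 \<in> homog V 0" "x1 \<in> homog V 1" "x = x0 + x1" using assms(2) by (rule vecsE)
  show ?thesis using x component_sum[OF assms(1) x(1,2), of p] by (simp add: homog_def)
qed

lemma component_add_component:
  assumes "superspace V" "x \<in> vecs V"
  shows "component V p x + component V (Suc p) x = x"
proof -
  obtain x0 x1 where x: "x0 \<in> homog V 0" "x1 \<in> homog V 1" "x = x0 + x1" using assms(2) by (rule vecsE)
  show ?thesis
    using component_sum[OF assms(1) x(1,2), of p] component_sum[OF assms(1) x(1,2), of "Suc p"] x(3)
    by (simp add: add.commute)
qed

lemma linear_on_add: "linear_on A f \<Longrightarrow> x \<in> A \<Longrightarrow> y \<in> A \<Longrightarrow> f (x + y) = f x + f y"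
  unfolding linear_on_def by (metis scaleR_one)

lemma linear_on_scale: "linear_on A f \<Longrightarrow> x \<in> A \<Longrightarrow> f (c *\<^sub>R x) = c *\<^sub>R f x"
  unfolding linear_on_def by (metis add.right_neutral scaleR_zero_left)

lemma linear_on_zero: "linear_on A f \<Longrightarrow> 0 \<in> A \<Longrightarrow> f 0 = 0"
  using linear_on_scale[of A f 0 0] by simp

lemma linear_on_sum:
  assumes "linear_on A f" "subspace A" "finite S" "\<And>i. i \<in> S \<Longrightarrow> g i \<in> A"
  shows "f (\<Sum>i\<in>S. g i) = (\<Sum>i\<in>S. f (g i))"
  using assms(3,4)
proof (induction S)
  case empty
  then show ?case using linear_on_zero[OF assms(1)] subspace_0[OF assms(2)] by simp
next
  case (insert i S)
  then show ?case
    using linear_on_add[OF assms(1), of "g i" "sum g S"] subspace_sum[OF assms(2), of S g] by simp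
qed

lemma linear_imp_linear_on: "linear f \<Longrightarrow> linear_on A f"
  by (simp add: linear_on_def linear_add linear_scale)

lemma linear_on_component:
  assumes V: "superspace V"
  shows "linear_on (vecs V) (component V p)"
  unfolding linear_on_def
proof (intro ballI allI)
  fix x y a b assume "x \<in> vecs V" "y \<in> vecs V"
  then obtain x0 x1 y0 y1 where x: "x0 \<in> homog V 0" "x1 \<in> homog V 1" "x = x0 + x1"
    and y: "y0 \<in> homog V 0" "y1 \<in> homog V 1" "y = y0 + y1"
    by (metis vecsE)
  have "a *\<^sub>R x0 + b *\<^sub>R y0 \<in> homog V 0" "a *\<^sub>R x1 + b *\<^sub>R y1 \<in> homog V 1"
    using x y subspace_homog[OF V] by (auto intro: subspace_add subspace_scale)
  from component_sum[OF V this, of p] component_sum[OF V x(1,2), of p]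
    component_sum[OF V y(1,2), of p]
  show "component V p (a *\<^sub>R x + b *\<^sub>R y) = a *\<^sub>R component V p x + b *\<^sub>R component V p y"
    unfolding x(3) y(3) by (simp add: algebra_simps)
qed

lemma linear_projection_exists:
  fixes S :: "'a::euclidean_space set"
  assumes "subspace S"
  obtains f where "linear f" "\<And>x. f x \<in> S" "\<And>x. x \<in> S \<Longrightarrow> f x = x"
  using linear_exists_left_inverse_on[OF linear_id assms] by auto

text \<open>
  Maps out of a superspace are prescribed separately on the two homogeneous parts; extending them
  to the whole ambient space spares all later carrier conditions for linearity.
\<close>
lemma linear_from_parts:
  fixes V :: "('a::euclidean_space, 'z) superspace_scheme" and f0 f1 :: "'a \<Rightarrow> 'b::real_vector"
  assumes V: "superspace V" and f: "linear f0" "linear f1"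
  obtains f where "linear f" "\<And>x. x \<in> even_part V \<Longrightarrow> f x = f0 x"
    "\<And>x. x \<in> odd_part V \<Longrightarrow> f x = f1 x"
proof -
  have s: "subspace (even_part V)" "subspace (odd_part V)" and i: "even_part V \<inter> odd_part V = {0}"
    using V by (auto simp: superspace_def)
  obtain q where q: "linear q" "\<And>x. q x \<in> odd_part V" "\<And>x. x \<in> odd_part V \<Longrightarrow> q x = x"
    using linear_projection_exists[OF s(2)] by blast
  define r where "r x = x - q x" for x
  have r: "linear r" unfolding r_def by (intro linear_compose_sub linear_id q(1) linear_ident)
  have "inj_on r (even_part V)"
  proof (rule inj_onI)
    fix x y assume xy: "x \<in> even_part V" "y \<in> even_part V" "r x = r y"
    then have "x - y = q x - q y" by (simp add: r_def algebra_simps)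
    then have "x - y \<in> even_part V \<inter> odd_part V"
      using xy s q(2) subspace_diff by (metis IntI)
    then show "x = y" unfolding i by simp
  qed
  from linear_exists_left_inverse_on[OF r s(1) this] obtain l where
    l: "linear l" "\<And>v. v \<in> even_part V \<Longrightarrow> l (r v) = v" by blast
  define f where "f x = f0 (l (r x)) + f1 (x - l (r x))" for x
  have lr: "linear (\<lambda>x. l (r x))" using linear_compose[OF r l(1)] by (simp add: o_def)
  have "linear f"
    unfolding f_def
    using linear_compose[OF lr f(1)] linear_compose[OF linear_compose_sub[OF linear_ident lr] f(2)]
    by (intro linear_compose_add) (simp_all add: o_def)
  moreover have "f x = f0 x" if "x \<in> even_part V" for x
    using that l(2) f(2) by (simp add: f_def linear_0)
  moreover have "f x = f1 x" if "x \<in> odd_part V" for x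
    using that q(3) l(1) f(1) by (simp add: f_def r_def linear_0)
  ultimately show ?thesis using that by blast
qed

lemma linear_on_extend:
  fixes A :: "'a::euclidean_space set" and f :: "'a \<Rightarrow> 'b::real_vector"
  assumes "linear_on A f" "subspace A"
  obtains f' where "linear f'" "\<And>x. x \<in> A \<Longrightarrow> f' x = f x"
proof -
  obtain q where q: "linear q" "\<And>x. q x \<in> A" "\<And>x. x \<in> A \<Longrightarrow> q x = x"
    using linear_projection_exists[OF assms(2)] by blast
  have "linear (\<lambda>x. f (q x))"
    using q assms(1)
    by (intro linearI) (simp_all add: linear_add linear_scale linear_on_add linear_on_scale)
  with q(3) show ?thesis using that[of "\<lambda>x. f (q x)"] by simp
qed

section \<open>Super skew-symmetric maps and algebras\<close>

context
  fixes V :: "('a::euclidean_space, 'y) superspace_scheme"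
    and W :: "('b::euclidean_space, 'z) superspace_scheme"
    and f :: "'a \<Rightarrow> 'a \<Rightarrow> 'b"
  assumes sk: "super_skew V W f"
begin

lemma super_skew_linear_right: "x \<in> vecs V \<Longrightarrow> linear_on (vecs V) (f x)"
  using sk unfolding super_skew_def by blast

lemma super_skew_linear_left: "y \<in> vecs V \<Longrightarrow> linear_on (vecs V) (\<lambda>x. f x y)"
  using sk unfolding super_skew_def by blast

lemmas super_skew_add_right = linear_on_add[OF super_skew_linear_right]
lemmas super_skew_add_left = linear_on_add[OF super_skew_linear_left]
lemmas super_skew_scale_right = linear_on_scale[OF super_skew_linear_right]
lemmas super_skew_scale_left = linear_on_scale[OF super_skew_linear_left]

lemma super_skew_homog: "x \<in> homog V p \<Longrightarrow> y \<in> homog V q \<Longrightarrow> f x y \<in> homog W (p + q)"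
  using sk unfolding super_skew_def by blast

lemma super_skew_swap:
  "x \<in> homog V p \<Longrightarrow> y \<in> homog V q \<Longrightarrow> f x y = - ((-1) ^ (p * q) *\<^sub>R f y x)"
  using sk unfolding super_skew_def by blast

lemma super_skew_vecs:
  assumes "superspace V" "superspace W" "x \<in> vecs V" "y \<in> vecs V"
  shows "f x y \<in> vecs W"
proof -
  obtain x0 x1 y0 y1 where x: "x0 \<in> homog V 0" "x1 \<in> homog V 1" "x = x0 + x1"
    and y: "y0 \<in> homog V 0" "y1 \<in> homog V 1" "y = y0 + y1"
    using assms(3,4) by (metis vecsE)
  have v: "x0 \<in> vecs V" "x1 \<in> vecs V" "y0 \<in> vecs V" "y1 \<in> vecs V"
    using x y homog_vecs[OF assms(1)] by blast+
  have "f x y = (f x0 y0 + f x0 y1) + (f x1 y0 + f x1 y1)"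
    using v assms(4) unfolding x(3)
    by (simp add: super_skew_add_left) (simp add: y(3) super_skew_add_right)
  moreover have "f a b \<in> vecs W" if "a \<in> homog V p" "b \<in> homog V q" for a b p q
    using super_skew_homog[OF that] homog_vecs[OF assms(2)] by blast
  ultimately show ?thesis
    using x(1,2) y(1,2) by (auto intro!: subspace_add subspace_vecs[OF assms(2)])
qed

end

text \<open>
  Ideals and the unitary radical are treated for graded super skew-symmetric brackets: this is what
  current algebras and their central extensions inherit by a direct computation, and it is enough
  for left ideals to be two-sided and for the radical to be an ideal.
\<close>
locale super_skew_algebra =
  fixes L :: "'a::euclidean_space superalgebra"
  assumes superspace: "superspace L" and skew: "super_skew L L (brkt L)"
begin

lemma brkt_vecs: "x \<in> vecs L \<Longrightarrow> y \<in> vecs L \<Longrightarrow> brkt L x y \<in> vecs L"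
  by (rule super_skew_vecs[OF skew superspace superspace])

lemma homog_in_vecs: "x \<in> homog L p \<Longrightarrow> x \<in> vecs L"
  using homog_vecs[OF superspace] by blast

lemmas brkt_homog = super_skew_homog[OF skew]
lemmas brkt_swap = super_skew_swap[OF skew]
lemmas brkt_add_right = super_skew_add_right[OF skew]
lemmas brkt_add_left = super_skew_add_left[OF skew]

lemma brkt_zero_right: "x \<in> vecs L \<Longrightarrow> brkt L x 0 = 0"
  by (rule linear_on_zero[OF super_skew_linear_right[OF skew] subspace_0[OF subspace_vecs[OF superspace]]])

lemma brkt_zero_left: "x \<in> vecs L \<Longrightarrow> brkt L 0 x = 0"
  by (rule linear_on_zero[OF super_skew_linear_left[OF skew] subspace_0[OF subspace_vecs[OF superspace]]])

lemma lsa_idealI: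
  assumes "subspace I"
    and split: "\<And>x. x \<in> I \<Longrightarrow> \<exists>x0 \<in> I \<inter> homog L 0. \<exists>x1 \<in> I \<inter> homog L 1. x = x0 + x1"
    and brkt: "\<And>p x y. x \<in> homog L p \<Longrightarrow> y \<in> I \<Longrightarrow> brkt L x y \<in> I"
  shows "lsa_ideal L I"
  unfolding lsa_ideal_def
proof (intro conjI ballI)
  show "I = {x + y |x y. x \<in> I \<inter> even_part L \<and> y \<in> I \<inter> odd_part L}" (is "I = ?S")
  proof
    show "I \<subseteq> ?S" using split unfolding homog_0 homog_1 by blast
    show "?S \<subseteq> I" using subspace_add[OF assms(1)] by blast
  qed
  fix x y assume x: "x \<in> vecs L" and y: "y \<in> I"
  obtain x0 x1 where x01: "x0 \<in> homog L 0" "x1 \<in> homog L 1" "x = x0 + x1" using x by (rule vecsE)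
  have "y \<in> vecs L" using split[OF y] vecsI by blast
  then have "brkt L x y = brkt L x0 y + brkt L x1 y"
    using x01 homog_in_vecs[OF x01(1)] homog_in_vecs[OF x01(2)] by (simp add: brkt_add_left)
  then show "brkt L x y \<in> I" using brkt[OF x01(1) y] brkt[OF x01(2) y] subspace_add[OF assms(1)] by simp
qed (rule assms(1))

end

lemma lsa_ideal_subspace: "lsa_ideal L I \<Longrightarrow> subspace I"
  by (simp add: lsa_ideal_def)

lemma lsa_ideal_brkt: "lsa_ideal L I \<Longrightarrow> x \<in> vecs L \<Longrightarrow> y \<in> I \<Longrightarrow> brkt L x y \<in> I"
  by (simp add: lsa_ideal_def)

lemma lsa_ideal_split:
  assumes "lsa_ideal L I" "x \<in> I"
  obtains x0 x1 where "x0 \<in> I" "x0 \<in> homog L 0" "x1 \<in> I" "x1 \<in> homog L 1" "x = x0 + x1"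
proof -
  have "I = {x + y |x y. x \<in> I \<inter> even_part L \<and> y \<in> I \<inter> odd_part L}"
    using assms(1) by (simp add: lsa_ideal_def)
  then show ?thesis using assms(2) that unfolding homog_0 homog_1 by blast
qed

lemma lsa_ideal_component:
  assumes "superspace L" "lsa_ideal L I" "x \<in> I"
  shows "component L p x \<in> I"
proof -
  obtain x0 x1 where x: "x0 \<in> I" "x0 \<in> homog L 0" "x1 \<in> I" "x1 \<in> homog L 1" "x = x0 + x1"
    by (rule lsa_ideal_split[OF assms(2,3)])
  show ?thesis using component_sum[OF assms(1) x(2,4), of p] x by simp
qed

lemma lsa_ideal_subset: "lsa_ideal L I \<Longrightarrow> I \<subseteq> vecs L"
  by (rule subsetI, erule (1) lsa_ideal_split) (simp add: vecsI)

context super_skew_algebra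
begin

lemma lsa_ideal_vecs: "lsa_ideal L (vecs L)"
proof (rule lsa_idealI)
  show "\<exists>x0 \<in> vecs L \<inter> homog L 0. \<exists>x1 \<in> vecs L \<inter> homog L 1. x = x0 + x1" if "x \<in> vecs L" for x
    using that by (rule vecsE) (use homog_in_vecs in blast)
  show "brkt L x y \<in> vecs L" if "x \<in> homog L p" "y \<in> vecs L" for p x y
    using brkt_vecs[OF homog_in_vecs[OF that(1)] that(2)] .
qed (rule subspace_vecs[OF superspace])

lemma lsa_ideal_brkt_right:
  assumes I: "lsa_ideal L I" and x: "x \<in> I" and y: "y \<in> vecs L"
  shows "brkt L x y \<in> I"
proof -
  obtain x0 x1 where x01: "x0 \<in> I" "x0 \<in> homog L 0" "x1 \<in> I" "x1 \<in> homog L 1" "x = x0 + x1"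
    by (rule lsa_ideal_split[OF I x])
  obtain y0 y1 where y01: "y0 \<in> homog L 0" "y1 \<in> homog L 1" "y = y0 + y1" using y by (rule vecsE)
  have h: "brkt L a b \<in> I" if "a \<in> I" "a \<in> homog L p" "b \<in> homog L q" for a b p q
    using brkt_swap[OF that(2,3)] lsa_ideal_brkt[OF I homog_in_vecs[OF that(3)] that(1)]
      lsa_ideal_subspace[OF I] by (simp add: subspace_neg subspace_scale)
  have v: "x0 \<in> vecs L" "x1 \<in> vecs L" "y0 \<in> vecs L" "y1 \<in> vecs L"
    using homog_in_vecs[OF x01(2)] homog_in_vecs[OF x01(4)]
      homog_in_vecs[OF y01(1)] homog_in_vecs[OF y01(2)] by simp_all
  have "brkt L x y = (brkt L x0 y0 + brkt L x0 y1) + (brkt L x1 y0 + brkt L x1 y1)"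
    using v y unfolding x01(5) by (simp add: brkt_add_left) (simp add: y01(3) brkt_add_right)
  then show ?thesis
    using h[OF x01(1,2) y01(1)] h[OF x01(1,2) y01(2)] h[OF x01(3,4) y01(1)] h[OF x01(3,4) y01(2)]
      lsa_ideal_subspace[OF I] by (simp add: subspace_add)
qed

lemma lsa_ideal_Inter:
  assumes "T \<noteq> {}" and T: "\<And>I. I \<in> T \<Longrightarrow> lsa_ideal L I"
  shows "lsa_ideal L (\<Inter>T)"
proof (rule lsa_idealI)
  show "subspace (\<Inter>T)" using T lsa_ideal_subspace by (auto intro: subspace_Inter)
  show "brkt L x y \<in> \<Inter>T" if "x \<in> homog L p" "y \<in> \<Inter>T" for p x y
    using that T lsa_ideal_brkt homog_in_vecs by blast
  fix x assume x: "x \<in> \<Inter>T"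
  obtain I where I: "I \<in> T" using assms(1) by blast
  obtain x0 x1 where x01: "x0 \<in> homog L 0" "x1 \<in> homog L 1" "x = x0 + x1"
    by (rule lsa_ideal_split[OF T[OF I]]) (use x I in blast)
  \<comment> \<open>The splitting of \<open>x\<close> is unique, so its parts lie in every member of \<open>T\<close>.\<close>
  have "x0 \<in> I' \<and> x1 \<in> I'" if I': "I' \<in> T" for I'
  proof -
    obtain y0 y1 where "y0 \<in> I'" "y0 \<in> homog L 0" "y1 \<in> I'" "y1 \<in> homog L 1" "x = y0 + y1"
      by (rule lsa_ideal_split[OF T[OF I']]) (use x I' in blast)
    then show ?thesis using homog_sum_eq_iff[OF superspace, of x0 y0 x1 y1] x01 by simp
  qed
  then show "\<exists>x0 \<in> \<Inter>T \<inter> homog L 0. \<exists>x1 \<in> \<Inter>T \<inter> homog L 1. x = x0 + x1" using x01 by blast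
qed

end

section \<open>The unitary radical\<close>

context super_skew_algebra
begin

lemma sq_cone_closed: "closed (sq_cone L)" and sq_cone_convex: "convex (sq_cone L)"
  and sq_cone_cone: "cone (sq_cone L)"
proof -
  have "(\<lambda>C. closed C \<and> convex C \<and> cone C) (sq_cone L)"
    unfolding sq_cone_def
    by (rule hull_in) (auto simp: cone_def convex_Inter closed_Inter)
  then show "closed (sq_cone L)" "convex (sq_cone L)" "cone (sq_cone L)" by auto
qed

lemma square_in_sq_cone: "x \<in> odd_part L \<Longrightarrow> brkt L x x \<in> sq_cone L"
  unfolding sq_cone_def by (rule hull_inc) auto

lemma sq_cone_minimal:
  assumes "closed C" "convex C" "cone C" "\<And>x. x \<in> odd_part L \<Longrightarrow> brkt L x x \<in> C"
  shows "sq_cone L \<subseteq> C"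
  unfolding sq_cone_def using assms by (intro hull_minimal) auto

lemma sq_cone_even: "sq_cone L \<subseteq> even_part L"
proof (rule sq_cone_minimal)
  have s: "subspace (even_part L)" using superspace by (simp add: superspace_def)
  then show "closed (even_part L)" "convex (even_part L)" "cone (even_part L)"
    by (auto simp: closed_subspace subspace_imp_convex cone_def subspace_scale)
  show "brkt L x x \<in> even_part L" if "x \<in> odd_part L" for x
    using brkt_homog[of x 1 x 1] that by (simp add: homog_def)
qed

lemma urad_ideal: "lsa_ideal L (urad L)"
  unfolding urad_def hull_def
proof (rule lsa_ideal_Inter)
  have "sq_cone_edge L \<union> {x \<in> odd_part L. brkt L x x \<in> sq_cone_edge L} \<subseteq> vecs L"
    using sq_cone_even homog_in_vecs[of _ 0] homog_in_vecs[of _ 1]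
    unfolding homog_0 homog_1 by (auto simp: sq_cone_edge_def)
  then show "{t. lsa_ideal L t \<and>
      sq_cone_edge L \<union> {x \<in> odd_part L. brkt L x x \<in> sq_cone_edge L} \<subseteq> t} \<noteq> {}"
    using lsa_ideal_vecs by blast
qed auto

lemma urad_contains:
  assumes "x \<in> odd_part L" "brkt L x x \<in> sq_cone_edge L"
  shows "x \<in> urad L"
  unfolding urad_def using assms by (intro hull_inc) auto

lemma urad_minimal:
  assumes "lsa_ideal L I" "sq_cone_edge L \<subseteq> I"
    "\<And>x. x \<in> odd_part L \<Longrightarrow> brkt L x x \<in> sq_cone_edge L \<Longrightarrow> x \<in> I"
  shows "urad L \<subseteq> I"
  unfolding urad_def using assms by (intro hull_minimal) auto

end

section \<open>Unitary representations vanish on the unitary radical\<close>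

locale unitary_representation = super_skew_algebra L
  for L :: "'a::euclidean_space superalgebra" +
  fixes H :: "'h::ab_group_add prehilbert" and \<rho> :: "'a \<Rightarrow> 'h \<Rightarrow> 'h"
  assumes rep: "unitary_rep L H \<rho>"
begin

sublocale H: vector_space "scaleH H"
  using rep by (simp add: unitary_rep_def prehilbert_superspace_def)

lemma H_subspace_homog: "H.subspace (homog H q)"
  using rep by (simp add: unitary_rep_def prehilbert_superspace_def homog_def)

lemma H_disjoint: "u \<in> homog H q \<Longrightarrow> u \<in> homog H (Suc q) \<Longrightarrow> u = 0"
proof -
  have "even_part H \<inter> odd_part H = {0}"
    using rep by (simp add: unitary_rep_def prehilbert_superspace_def)
  then show "u \<in> homog H q \<Longrightarrow> u \<in> homog H (Suc q) \<Longrightarrow> u = 0"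
    by (cases "even q") (auto simp: homog_def)
qed

lemma H_homog_vecs: "u \<in> homog H q \<Longrightarrow> u \<in> vecs H"
proof -
  assume u: "u \<in> homog H q"
  have "0 \<in> homog H 0" "0 \<in> homog H 1" using H.subspace_0[OF H_subspace_homog] by blast+
  then show "u \<in> vecs H"
    using u vecsI[of u H 0] vecsI[of 0 H u] homog_cong[of q 0 H] homog_cong[of q 1 H] by (cases "even q") auto
qed

lemma H_subspace_vecs: "H.subspace (vecs H)"
  using H.subspace_sums[OF H_subspace_homog[of 0] H_subspace_homog[of 1]]
  by (simp add: vecs_def homog_def)

lemmas rho_lincomb_right = rep[unfolded unitary_rep_def, THEN conjunct2, THEN conjunct1, rule_format]

lemmas rho_lincomb_left =
  rep[unfolded unitary_rep_def, THEN conjunct2, THEN conjunct2, THEN conjunct1, rule_format]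

lemma rho_add_right:
  assumes "X \<in> vecs L" "u \<in> vecs H" "v \<in> vecs H"
  shows "\<rho> X (u + v) = \<rho> X u + \<rho> X v"
  using rho_lincomb_right[OF assms, of 1 1] by simp

lemma rho_scale_right:
  assumes "X \<in> vecs L" "u \<in> vecs H"
  shows "\<rho> X (scaleH H a u) = scaleH H a (\<rho> X u)"
  using rho_lincomb_right[OF assms assms(2), of a 0] by simp

lemma rho_zero_right: "X \<in> vecs L \<Longrightarrow> \<rho> X 0 = 0"
  using rho_scale_right[of X 0 0] H.subspace_0[OF H_subspace_vecs] by simp

lemma rho_add_left:
  assumes "X \<in> vecs L" "Y \<in> vecs L" "v \<in> vecs H"
  shows "\<rho> (X + Y) v = \<rho> X v + \<rho> Y v"
  using rho_lincomb_left[OF assms, of 1 1] by simp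

lemmas rho_homog =
  rep[unfolded unitary_rep_def, THEN conjunct2, THEN conjunct2, THEN conjunct2, THEN conjunct1, rule_format]

lemmas rho_brkt =
  rep[unfolded unitary_rep_def, THEN conjunct2, THEN conjunct2, THEN conjunct2, THEN conjunct2,
    THEN conjunct1, rule_format]

lemma rho_adjoint:
  assumes "X \<in> homog L p" "p < 2" "u \<in> vecs H" "v \<in> vecs H"
  shows "innerH H (\<rho> X u) v = innerH H u (scaleH H (- (\<i> ^ p)) (\<rho> X v))"
  using rep[unfolded unitary_rep_def, THEN conjunct2, THEN conjunct2, THEN conjunct2, THEN conjunct2,
      THEN conjunct2, rule_format, OF assms(2,1,3,4)] .

lemma rho_vecs:
  assumes "X \<in> vecs L" "v \<in> vecs H"
  shows "\<rho> X v \<in> vecs H"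
proof -
  obtain X0 X1 where X: "X0 \<in> homog L 0" "X1 \<in> homog L 1" "X = X0 + X1" using assms(1) by (rule vecsE)
  obtain v0 v1 where v: "v0 \<in> homog H 0" "v1 \<in> homog H 1" "v = v0 + v1" using assms(2) by (rule vecsE)
  note V = X(1,2)[THEN homog_in_vecs] v(1,2)[THEN H_homog_vecs]
  have "\<rho> X v = (\<rho> X0 v0 + \<rho> X1 v0) + (\<rho> X0 v1 + \<rho> X1 v1)"
    unfolding v(3) rho_add_right[OF assms(1) V(3,4)]
    unfolding X(3) rho_add_left[OF V(1,2,3)] rho_add_left[OF V(1,2,4)] ..
  then show ?thesis
    using X(1,2)[THEN rho_homog, OF v(1), THEN H_homog_vecs] X(1,2)[THEN rho_homog, OF v(2), THEN H_homog_vecs]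
    by (simp add: H.subspace_add[OF H_subspace_vecs])
qed

lemmas H_space = rep[unfolded unitary_rep_def, THEN conjunct1, unfolded prehilbert_superspace_def]

lemmas inner_lincomb =
  H_space[THEN conjunct2, THEN conjunct2, THEN conjunct2, THEN conjunct2, THEN conjunct1, rule_format]

lemmas inner_cnj =
  H_space[THEN conjunct2, THEN conjunct2, THEN conjunct2, THEN conjunct2, THEN conjunct2,
    THEN conjunct1, rule_format]

lemma inner_scale_left:
  assumes "u \<in> vecs H" "w \<in> vecs H"
  shows "innerH H (scaleH H a u) w = a * innerH H u w"
  using inner_lincomb[OF assms(1) assms(1) assms(2), of a 0] by simp

lemma inner_add_left:
  assumes "u \<in> vecs H" "v \<in> vecs H" "w \<in> vecs H"
  shows "innerH H (u + v) w = innerH H u w + innerH H v w"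
  using inner_lincomb[OF assms, of 1 1] by simp

lemma inner_scale_right:
  assumes "u \<in> vecs H" "w \<in> vecs H"
  shows "innerH H u (scaleH H a w) = cnj a * innerH H u w"
  using inner_scale_left[OF assms(2,1), of a] inner_cnj assms H.subspace_scale[OF H_subspace_vecs]
  by (metis complex_cnj_mult)

lemma inner_add_right:
  assumes "u \<in> vecs H" "v \<in> vecs H" "w \<in> vecs H"
  shows "innerH H w (u + v) = innerH H w u + innerH H w v"
  using inner_add_left[OF assms] inner_cnj assms H.subspace_add[OF H_subspace_vecs]
  by (metis complex_cnj_add)

lemma inner_pos:
  assumes "u \<in> vecs H"
  shows "Im (innerH H u u) = 0" "Re (innerH H u u) \<ge> 0" "innerH H u u = 0 \<Longrightarrow> u = 0"
proof -
  note p = H_space[THEN conjunct2, THEN conjunct2, THEN conjunct2, THEN conjunct2, THEN conjunct2,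
      THEN conjunct2, THEN conjunct1, rule_format]
  have z: "innerH H 0 0 = 0"
    using inner_scale_left[of 0 0 0] H.subspace_0[OF H_subspace_vecs] by simp
  show "Im (innerH H u u) = 0" "Re (innerH H u u) \<ge> 0" "innerH H u u = 0 \<Longrightarrow> u = 0"
    using p[OF assms] z by (cases "u = 0"; force)+
qed

definition rep_kernel :: "'a set" where
  "rep_kernel = {X \<in> vecs L. \<forall>v\<in>vecs H. \<rho> X v = 0}"

text \<open>
  The kernel is graded because the even and the odd part of \<open>X\<close> send a homogeneous vector into
  different homogeneous subspaces.
\<close>
lemma rep_kernel_split:
  assumes X: "X0 \<in> homog L 0" "X1 \<in> homog L 1" and k: "X0 + X1 \<in> rep_kernel"
  shows "X0 \<in> rep_kernel" "X1 \<in> rep_kernel"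
proof -
  note V = X[THEN homog_in_vecs]
  have h: "\<rho> X0 v = 0 \<and> \<rho> X1 v = 0" if v: "v \<in> homog H q" for v q
  proof -
    note vv = H_homog_vecs[OF v]
    have "\<rho> X0 v + \<rho> X1 v = 0" using k rho_add_left[OF V vv] vv by (simp add: rep_kernel_def)
    then have e: "\<rho> X1 v = - \<rho> X0 v" by (simp add: eq_neg_iff_add_eq_0 add.commute)
    have "\<rho> X0 v \<in> homog H q" "\<rho> X1 v \<in> homog H (Suc q)"
      using rho_homog[OF X(1) v] rho_homog[OF X(2) v] by simp_all
    then have "\<rho> X1 v \<in> homog H q" unfolding e using H.subspace_neg[OF H_subspace_homog] by blast
    then have "\<rho> X1 v = 0" using \<open>\<rho> X1 v \<in> homog H (Suc q)\<close> H_disjoint by blast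
    then show ?thesis using e by simp
  qed
  have "\<rho> X0 v = 0 \<and> \<rho> X1 v = 0" if vv: "v \<in> vecs H" for v
  proof -
    obtain v0 v1 where v: "v0 \<in> homog H 0" "v1 \<in> homog H 1" "v = v0 + v1" using vv by (rule vecsE)
    show ?thesis
      using h[OF v(1)] h[OF v(2)] unfolding v(3)
      by (simp add: rho_add_right V H_homog_vecs[OF v(1)] H_homog_vecs[OF v(2)])
  qed
  then show "X0 \<in> rep_kernel" "X1 \<in> rep_kernel" using V by (auto simp: rep_kernel_def)
qed

lemma rep_kernel_ideal: "lsa_ideal L rep_kernel"
proof (rule lsa_idealI)
  show s: "subspace rep_kernel"
  proof (rule subspaceI)
    show "0 \<in> rep_kernel"
      using rho_lincomb_left[of 0 0 _ 0 0] subspace_0[OF subspace_vecs[OF superspace]]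
      by (simp add: rep_kernel_def)
    show "X + Y \<in> rep_kernel" if "X \<in> rep_kernel" "Y \<in> rep_kernel" for X Y
      using that rho_add_left subspace_add[OF subspace_vecs[OF superspace]]
      by (simp add: rep_kernel_def)
    show "c *\<^sub>R X \<in> rep_kernel" if "X \<in> rep_kernel" for c X
      using that rho_lincomb_left[of X X _ c 0] subspace_scale[OF subspace_vecs[OF superspace]]
      by (simp add: rep_kernel_def)
  qed
  show split: "\<exists>x0 \<in> rep_kernel \<inter> homog L 0. \<exists>x1 \<in> rep_kernel \<inter> homog L 1. X = x0 + x1"
    if X: "X \<in> rep_kernel" for X
  proof -
    have "X \<in> vecs L" using X by (simp add: rep_kernel_def)
    then obtain X0 X1 where X01: "X0 \<in> homog L 0" "X1 \<in> homog L 1" "X = X0 + X1" by (rule vecsE)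
    then show ?thesis using rep_kernel_split[OF X01(1,2)] X by blast
  qed
  fix p X Y assume X: "X \<in> homog L p" and Y: "Y \<in> rep_kernel"
  have h: "brkt L X Z \<in> rep_kernel" if "Z \<in> rep_kernel" "Z \<in> homog L q" for Z q
    using rho_brkt[OF X that(2)] rho_vecs[OF homog_in_vecs[OF X]] rho_zero_right[OF homog_in_vecs[OF X]]
      that brkt_vecs[OF homog_in_vecs[OF X]] by (simp add: rep_kernel_def)
  obtain Y0 Y1 where Y01: "Y0 \<in> rep_kernel" "Y0 \<in> homog L 0" "Y1 \<in> rep_kernel" "Y1 \<in> homog L 1" "Y = Y0 + Y1"
    using split[OF Y] by blast
  have "brkt L X Y = brkt L X Y0 + brkt L X Y1"
    unfolding Y01(5) by (rule brkt_add_right[OF homog_in_vecs[OF X] homog_in_vecs[OF Y01(2)] homog_in_vecs[OF Y01(4)]])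
  then show "brkt L X Y \<in> rep_kernel"
    using h[OF Y01(1,2)] h[OF Y01(3,4)] subspace_add[OF s] by simp
qed

lemma inner_rho_square:
  assumes x: "x \<in> odd_part L" and u: "u \<in> vecs H"
  shows "2 * innerH H (\<rho> x u) (\<rho> x u) = \<i> * innerH H u (\<rho> (brkt L x x) u)"
proof -
  have xh: "x \<in> homog L 1" using x by (simp add: homog_def)
  have xv: "\<rho> x u \<in> vecs H" "\<rho> x (\<rho> x u) \<in> vecs H"
    using rho_vecs[OF homog_in_vecs[OF xh]] u by blast+
  have "\<rho> (brkt L x x) u = \<rho> x (\<rho> x u) + \<rho> x (\<rho> x u)"
    using rho_brkt[OF xh xh u] by simp
  then have "innerH H u (\<rho> (brkt L x x) u) = 2 * innerH H u (\<rho> x (\<rho> x u))"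
    using inner_add_right[OF xv(2) xv(2) u] by simp
  moreover have "innerH H (\<rho> x u) (\<rho> x u) = \<i> * innerH H u (\<rho> x (\<rho> x u))"
    using rho_adjoint[OF xh _ u xv(1)] inner_scale_right[OF u xv(2), of "-\<i>"] by simp
  ultimately show ?thesis by simp
qed

text \<open>
  The expectation values \<open>\<langle>u, -i \<rho>(y) u\<rangle>\<close> are nonnegative for \<open>y = [x, x]\<close>, because
  \<open>\<rho>(y) = 2 \<rho>(x)\<^sup>2\<close> turns them into \<open>2 \<langle>\<rho>(x) u, \<rho>(x) u\<rangle>\<close>; being linear, hence
  continuous, in \<open>y\<close>, they are nonnegative on the whole cone.
\<close>
lemma expectation_nonneg:
  assumes y: "y \<in> sq_cone L" and u: "u \<in> vecs H"
  shows "Re (\<i> * innerH H u (\<rho> y u)) \<ge> 0"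
proof -
  define \<phi> where "\<phi> y = Re (\<i> * innerH H u (\<rho> y u))" for y
  have "linear_on (vecs L) \<phi>"
    unfolding linear_on_def \<phi>_def
  proof (intro ballI allI)
    fix X Y and a b :: real assume XY: "X \<in> vecs L" "Y \<in> vecs L"
    have "\<rho> (a *\<^sub>R X + b *\<^sub>R Y) u = scaleH H (of_real a) (\<rho> X u) + scaleH H (of_real b) (\<rho> Y u)"
      by (rule rho_lincomb_left[OF XY u])
    then show "Re (\<i> * innerH H u (\<rho> (a *\<^sub>R X + b *\<^sub>R Y) u)) =
        a *\<^sub>R Re (\<i> * innerH H u (\<rho> X u)) + b *\<^sub>R Re (\<i> * innerH H u (\<rho> Y u))"
      using rho_vecs[OF XY(1) u] rho_vecs[OF XY(2) u] u
      by (simp add: inner_add_right inner_scale_right H.subspace_scale[OF H_subspace_vecs])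
  qed
  then obtain \<psi> where \<psi>: "linear \<psi>" "\<And>x. x \<in> vecs L \<Longrightarrow> \<psi> x = \<phi> x"
    using linear_on_extend subspace_vecs[OF superspace] by blast
  have "sq_cone L \<subseteq> {y. \<psi> y \<ge> 0}"
  proof (rule sq_cone_minimal)
    have "continuous_on UNIV \<psi>" using \<psi>(1) by (simp add: linear_continuous_on linear_conv_bounded_linear)
    then show "closed {y. 0 \<le> \<psi> y}" by (intro closed_Collect_le continuous_intros)
    show "cone {y. 0 \<le> \<psi> y}" using \<psi>(1) by (simp add: cone_def linear_scale)
    show "convex {y. 0 \<le> \<psi> y}" using \<psi>(1) by (simp add: convex_def linear_add linear_scale)
    fix x assume x: "x \<in> odd_part L"
    have xv: "x \<in> vecs L" using x homog_in_vecs[of x 1] by (simp add: homog_def)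
    have "\<phi> (brkt L x x) = 2 * Re (innerH H (\<rho> x u) (\<rho> x u))"
      using arg_cong[OF inner_rho_square[OF x u], of Re] by (simp add: \<phi>_def)
    then show "brkt L x x \<in> {y. 0 \<le> \<psi> y}"
      using \<psi>(2)[OF brkt_vecs[OF xv xv]] inner_pos(2)[OF rho_vecs[OF xv u]] by simp
  qed
  moreover have "y \<in> vecs L" using y sq_cone_even homog_in_vecs[of y 0] by (auto simp: homog_def)
  ultimately have "\<phi> y \<ge> 0" using y \<psi>(2) by auto
  then show ?thesis by (simp add: \<phi>_def)
qed

text \<open>
  On the edge all expectation values of \<open>-i \<rho>(y)\<close> vanish; a symmetric operator with this property
  is zero.
\<close>
lemma edge_rep_kernel:
  assumes y: "y \<in> sq_cone_edge L"
  shows "y \<in> rep_kernel"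
proof -
  have yc: "y \<in> sq_cone L" "- y \<in> sq_cone L" using y by (auto simp: sq_cone_edge_def)
  then have yh: "y \<in> homog L 0" using sq_cone_even by (auto simp: homog_def)
  note yv = homog_in_vecs[OF yh]
  have q: "innerH H u (\<rho> y u) = 0" if u: "u \<in> vecs H" for u
  proof -
    note r = rho_vecs[OF yv u]
    have "\<rho> (- y) u = scaleH H (- 1) (\<rho> y u)" using rho_lincomb_left[OF yv yv u, of "-1" 0] by simp
    then have "innerH H u (\<rho> (- y) u) = - innerH H u (\<rho> y u)"
      using inner_scale_right[OF u r, of "-1"] by simp
    then have "Re (\<i> * innerH H u (\<rho> y u)) = 0"
      using expectation_nonneg[OF yc(1) u] expectation_nonneg[OF yc(2) u] by simp
    moreover have "cnj (innerH H u (\<rho> y u)) = - innerH H u (\<rho> y u)"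
      using rho_adjoint[OF yh _ u u] inner_cnj[OF u r] inner_scale_right[OF u r, of "-1"] by simp
    ultimately show ?thesis by (simp add: complex_eq_iff)
  qed
  have "\<rho> y v = 0" if v: "v \<in> vecs H" for v
  proof -
    define u where "u = \<rho> y v"
    have u: "u \<in> vecs H" unfolding u_def by (rule rho_vecs[OF yv v])
    have iv: "scaleH H \<i> v \<in> vecs H" using H.subspace_scale[OF H_subspace_vecs v] .
    have r: "\<rho> y u \<in> vecs H" "\<rho> y v \<in> vecs H" "scaleH H \<i> (\<rho> y v) \<in> vecs H"
      using rho_vecs[OF yv] u v H.subspace_scale[OF H_subspace_vecs] by blast+
    \<comment> \<open>Complex polarization, with \<open>u + v\<close> and \<open>u + i v\<close>.\<close>
    have "innerH H (u + v) (\<rho> y (u + v)) = 0"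
      "innerH H (u + scaleH H \<i> v) (\<rho> y (u + scaleH H \<i> v)) = 0"
      using q H.subspace_add[OF H_subspace_vecs u] v iv by blast+
    then have "innerH H u (\<rho> y v) + innerH H v (\<rho> y u) = 0"
      "- \<i> * innerH H u (\<rho> y v) + \<i> * innerH H v (\<rho> y u) = 0"
      using q[OF u] q[OF v] u v iv r
      by (simp_all add: rho_add_right[OF yv] rho_scale_right[OF yv] inner_add_left inner_add_right
          inner_scale_left inner_scale_right H.subspace_add[OF H_subspace_vecs] algebra_simps)
    then have "innerH H u (\<rho> y v) = 0" by (simp add: complex_eq_iff)
    then show ?thesis using inner_pos(3)[OF u] by (simp add: u_def)
  qed
  then show ?thesis using yv by (simp add: rep_kernel_def)
qed

lemma urad_subset_rep_kernel: "urad L \<subseteq> rep_kernel"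
proof (rule urad_minimal[OF rep_kernel_ideal])
  show "sq_cone_edge L \<subseteq> rep_kernel" using edge_rep_kernel by blast
  fix x assume x: "x \<in> odd_part L" "brkt L x x \<in> sq_cone_edge L"
  have xv: "x \<in> vecs L" using x homog_in_vecs[of x 1] by (simp add: homog_def)
  have "\<rho> x u = 0" if u: "u \<in> vecs H" for u
  proof -
    have "\<rho> (brkt L x x) u = 0" using edge_rep_kernel[OF x(2)] u by (simp add: rep_kernel_def)
    moreover have "innerH H u 0 = 0"
      using inner_scale_right[OF u u, of 0] by simp
    ultimately have "innerH H (\<rho> x u) (\<rho> x u) = 0" using inner_rho_square[OF x(1) u] by simp
    then show ?thesis using inner_pos(3)[OF rho_vecs[OF xv u]] by blast
  qed
  then show "x \<in> rep_kernel" using xv by (simp add: rep_kernel_def)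
qed

end

section \<open>The current algebra\<close>

lemma tensor_blade: "tensor (blade I) x = axis I x"
  by (simp add: tensor_def blade_def axis_def vec_eq_iff)

lemma axis_lincomb: "axis I (a *\<^sub>R x + b *\<^sub>R y) = a *\<^sub>R axis I x + b *\<^sub>R axis I y"
  by (simp add: axis_def vec_eq_iff)

lemma vec_eq_sum_axis: "(X :: 'a::real_vector ^ 'i::finite) = (\<Sum>I\<in>UNIV. axis I (X $ I))"
  by (simp add: vec_eq_iff axis_def)

lemma axis_scale: "axis I (c *\<^sub>R x) = c *\<^sub>R axis I x"
  and axis_add: "axis I (x + y) = axis I x + axis I y"
  and axis_uminus: "axis I (- z) = - axis I z"
  for x y :: "'a::real_vector" and z :: "'b::real_vector"
  by (simp_all add: axis_def vec_eq_iff)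

lemma gsign_swap:
  fixes I J :: "'s::{finite,linorder} set"
  shows "gsign I J = (-1) ^ (card I * card J) * gsign J I"
proof (cases "I \<inter> J = {}")
  case True
  let ?A = "{(i, j). i \<in> I \<and> j \<in> J \<and> j < i}" and ?B = "{(j, i). j \<in> J \<and> i \<in> I \<and> i < j}"
  \<comment> \<open>Every pair in \<open>I \<times> J\<close> is an inversion of exactly one of the two products.\<close>
  have "I \<times> J = ?A \<union> prod.swap ` ?B"
  proof
    show "I \<times> J \<subseteq> ?A \<union> prod.swap ` ?B"
    proof (rule subrelI)
      fix i j assume ij: "(i, j) \<in> I \<times> J"
      then have "i \<noteq> j" using True by auto
      then consider "j < i" | "i < j" by (meson linorder_neqE)
      then show "(i, j) \<in> ?A \<union> prod.swap ` ?B"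
        using ij by cases (auto simp: image_iff)
    qed
  qed auto
  moreover have "?A \<inter> prod.swap ` ?B = {}" by auto
  ultimately have "card (I \<times> J) = card ?A + card (prod.swap ` ?B)"
    by (simp only: card_Un_disjoint[OF finite finite])
  then have e: "card I * card J = card ?A + card ?B" by (simp add: card_image card_cartesian_product)
  have "(-1::real) ^ card ?A = (-1) ^ (card ?A + card ?B) * (-1) ^ card ?B"
    by (simp add: power_add)
  then show ?thesis using True e by (simp add: gsign_def Int_commute)
qed (simp add: gsign_def Int_commute)

lemma axis_zero: "axis I (0 :: 'a::real_vector) = 0"
  by (simp add: axis_def vec_eq_iff)

lemma gsign_nonzero: "I \<inter> J = {} \<Longrightarrow> gsign I J \<noteq> 0"
  by (simp add: gsign_def)

lemma gsign_empty: "gsign {} I = 1" "gsign I {} = 1"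
  by (simp_all add: gsign_def)

lemma homog_current: "homog (current L) p = {X. \<forall>I. X $ I \<in> homog L (card I + p)}"
  by (auto simp: homog_def current_def)

lemma superspace_current:
  fixes L :: "'a::euclidean_space superalgebra"
  assumes L: "superspace L"
  shows "superspace (current L :: ('a ^ ('s::{finite,linorder} set)) superalgebra)"
proof -
  let ?C = "current L :: ('a ^ ('s set)) superalgebra"
  have "subspace (homog ?C p)" for p
    unfolding homog_current using subspace_homog[OF L]
    by (auto simp: subspace_def)
  from this[of 0] this[of 1] have "subspace (even_part ?C)" "subspace (odd_part ?C)"
    by (simp_all add: homog_0 homog_1[unfolded One_nat_def])
  moreover have "X = 0" if "X \<in> even_part ?C" "X \<in> odd_part ?C"
    for X :: "'a ^ 's set"
  proof (rule vec_eq_iff[THEN iffD2], rule allI)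
    fix I
    have "X $ I \<in> homog L (card I)" "X $ I \<in> homog L (card I + 1)"
      using that by (simp_all add: current_def)
    then have "X $ I \<in> even_part L \<inter> odd_part L" by (cases "even (card I)") (auto simp: homog_def)
    then show "X $ I = 0 $ I" using L unfolding superspace_def by simp
  qed
  moreover have "0 \<in> even_part ?C \<inter> odd_part ?C"
    using calculation(1,2) subspace_0 by blast
  ultimately show ?thesis unfolding superspace_def by blast
qed

lemma vecs_current:
  fixes L :: "'a::euclidean_space superalgebra"
  assumes L: "superspace L"
  shows "vecs (current L) = {X :: 'a ^ ('s::{finite,linorder} set). \<forall>I. X $ I \<in> vecs L}"
    (is "?C = ?D")
proof
  show "?C \<subseteq> ?D"
  proof
    fix X :: "'a ^ 's set" assume "X \<in> vecs (current L)"
    then obtain X0 X1 where X: "X0 \<in> homog (current L) 0" "X1 \<in> homog (current L) 1" "X = X0 + X1"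
      by (rule vecsE)
    have "X0 $ I \<in> vecs L" "X1 $ I \<in> vecs L" for I
      using X(1,2) homog_vecs[OF L] unfolding homog_current by blast+
    then show "X \<in> ?D"
      unfolding X(3) using subspace_add[OF subspace_vecs[OF L]] by simp
  qed
  show "?D \<subseteq> ?C"
  proof
    fix X :: "'a ^ 's set" assume X: "X \<in> ?D"
    define Y where "Y p = (\<chi> I. component L (card I + p) (X $ I))" for p
    have "Y p \<in> homog (current L) p" for p
      using X component_homog_in[OF L] by (simp add: Y_def homog_current)
    moreover have "X = Y 0 + Y 1"
      using X component_add_component[OF L] by (simp add: Y_def vec_eq_iff)
    ultimately show "X \<in> vecs (current L)" using vecsI[of "Y 0" "current L" "Y 1"] by simp
  qed
qed

lemma axis_homog_current:
  assumes "superspace L" "x \<in> homog L (card I + p)"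
  shows "axis I x \<in> homog (current L) p"
  using assms subspace_0[OF subspace_homog[OF assms(1)]] by (auto simp: homog_current axis_def)

lemma axis_vecs_current:
  assumes "superspace L" "x \<in> vecs L"
  shows "axis I x \<in> vecs (current L)"
  using assms subspace_0[OF subspace_vecs[OF assms(1)]] by (auto simp: vecs_current axis_def)

context super_skew_algebra
begin

lemma current_brkt_axis:
  fixes X Y :: "'a ^ ('s::{finite,linorder} set)"
  shows "current_brkt L X Y = (\<Sum>I\<in>UNIV. \<Sum>J\<in>UNIV. \<Sum>p<2.
    ((-1) ^ (p * card J) * gsign I J) *\<^sub>R axis (I \<union> J) (brkt L (component L p (X $ I)) (Y $ J)))"
proof -
  have "tensor (gmult (blade I) (blade J)) x = gsign I J *\<^sub>R axis (I \<union> J) x" for I J :: "'s set" and x :: 'a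
    unfolding gmult_blade tensor_blade[symmetric] by (simp add: tensor_def vec_eq_iff)
  then show ?thesis by (simp add: current_brkt_def)
qed

text \<open>On homogeneous left arguments only one parity of each coefficient contributes.\<close>
lemma current_brkt_homog:
  assumes X: "X \<in> homog (current L) p" and Y: "Y \<in> vecs (current L)"
  shows "current_brkt L X Y = (\<Sum>I\<in>UNIV. \<Sum>J\<in>UNIV.
    ((-1) ^ ((card I + p) * card J) * gsign I J) *\<^sub>R axis (I \<union> J) (brkt L (X $ I) (Y $ J)))"
  unfolding current_brkt_axis
proof (intro sum.cong refl)
  fix I J
  have x: "X $ I \<in> homog L (card I + p)" using X by (simp add: homog_current)
  have y: "Y $ J \<in> vecs L" using Y by (simp add: vecs_current[OF superspace])
  have s: "(-1::real) ^ (r * card J) = (-1) ^ ((card I + p) * card J)" if "even (card I + p) = even r" for r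
    using that by (simp add: minus_one_power_iff)
  have t: "((-1) ^ (r * card J) * gsign I J) *\<^sub>R axis (I \<union> J) (brkt L (component L r (X $ I)) (Y $ J))
      = (if even (card I + p) = even r
        then ((-1) ^ ((card I + p) * card J) * gsign I J) *\<^sub>R axis (I \<union> J) (brkt L (X $ I) (Y $ J)) else 0)" for r
    using s[of r] component_homog[OF superspace x, of r] brkt_zero_left[OF y]
    by (cases "even (card I + p) = even r") auto
  show "(\<Sum>r<2. ((-1) ^ (r * card J) * gsign I J) *\<^sub>R
      axis (I \<union> J) (brkt L (component L r (X $ I)) (Y $ J))) =
      ((-1) ^ ((card I + p) * card J) * gsign I J) *\<^sub>R axis (I \<union> J) (brkt L (X $ I) (Y $ J))"
    unfolding t by (simp add: numeral_2_eq_2)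
qed

lemma component_vecs: "x \<in> vecs L \<Longrightarrow> component L p x \<in> vecs L"
  using component_homog_in[OF superspace] homog_in_vecs by blast

lemma current_super_skew:
  "super_skew (current L :: ('a ^ ('s::{finite,linorder} set)) superalgebra) (current L) (current_brkt L)"
  unfolding super_skew_def
proof (intro conjI ballI allI)
  fix X :: "'a ^ 's set" assume X: "X \<in> vecs (current L)"
  then have Xv: "X $ I \<in> vecs L" for I by (simp add: vecs_current[OF superspace])
  note cX = component_vecs[OF Xv]
  show "linear_on (vecs (current L)) (current_brkt L X)"
    unfolding linear_on_def
  proof (intro ballI allI)
    fix Y Z :: "'a ^ 's set" and a b assume "Y \<in> vecs (current L)" "Z \<in> vecs (current L)"
    then have "Y $ I \<in> vecs L" "Z $ I \<in> vecs L" for I by (simp_all add: vecs_current[OF superspace])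
    then have "brkt L (component L p (X $ I)) ((a *\<^sub>R Y + b *\<^sub>R Z) $ J) =
        a *\<^sub>R brkt L (component L p (X $ I)) (Y $ J) + b *\<^sub>R brkt L (component L p (X $ I)) (Z $ J)" for p I J
      using super_skew_linear_right[OF skew cX] unfolding linear_on_def by simp
    then show "current_brkt L X (a *\<^sub>R Y + b *\<^sub>R Z) = a *\<^sub>R current_brkt L X Y + b *\<^sub>R current_brkt L X Z"
      by (simp only: current_brkt_axis axis_lincomb scaleR_add_right sum.distrib scaleR_sum_right
          scaleR_left_commute)
  qed
  show "linear_on (vecs (current L)) (\<lambda>Y. current_brkt L Y X)"
    unfolding linear_on_def
  proof (intro ballI allI)
    fix Y Z :: "'a ^ 's set" and a b assume "Y \<in> vecs (current L)" "Z \<in> vecs (current L)"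
    then have v: "Y $ I \<in> vecs L" "Z $ I \<in> vecs L" for I by (simp_all add: vecs_current[OF superspace])
    then have "component L p ((a *\<^sub>R Y + b *\<^sub>R Z) $ I) =
        a *\<^sub>R component L p (Y $ I) + b *\<^sub>R component L p (Z $ I)" for p I
      using linear_on_component[OF superspace, of p] unfolding linear_on_def by simp
    then have "brkt L (component L p ((a *\<^sub>R Y + b *\<^sub>R Z) $ I)) (X $ J) =
        a *\<^sub>R brkt L (component L p (Y $ I)) (X $ J) + b *\<^sub>R brkt L (component L p (Z $ I)) (X $ J)" for p I J
      using super_skew_linear_left[OF skew Xv[of J]] component_vecs[OF v(1)] component_vecs[OF v(2)]
      unfolding linear_on_def by simp
    then show "current_brkt L (a *\<^sub>R Y + b *\<^sub>R Z) X = a *\<^sub>R current_brkt L Y X + b *\<^sub>R current_brkt L Z X"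
      by (simp only: current_brkt_axis axis_lincomb scaleR_add_right sum.distrib scaleR_sum_right
          scaleR_left_commute)
  qed
next
  fix p q and X Y :: "'a ^ 's set"
  assume X: "X \<in> homog (current L) p" and Y: "Y \<in> homog (current L) q"
  note sc = superspace_current[OF superspace]
  have XYv: "X \<in> vecs (current L)" "Y \<in> vecs (current L)" using X Y homog_vecs[OF sc] by blast+
  have x: "X $ I \<in> homog L (card I + p)" and y: "Y $ I \<in> homog L (card I + q)" for I
    using X Y by (simp_all add: homog_current)
  have h: "gsign I J *\<^sub>R axis (I \<union> J) (brkt L (X $ I) (Y $ J)) \<in> homog (current L) (p + q)" for I J
  proof (cases "I \<inter> J = {}")
    case True
    then have par: "even (card I + p + (card J + q)) = even (card (I \<union> J) + (p + q))"
      by (simp add: card_Un_disjoint) blast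
    have "brkt L (X $ I) (Y $ J) \<in> homog L (card (I \<union> J) + (p + q))"
      using brkt_homog[OF x[of I] y[of J]] unfolding homog_cong[OF par] .
    then show ?thesis
      by (intro subspace_scale[OF subspace_homog[OF sc]] axis_homog_current[OF superspace])
  qed (simp add: gsign_def subspace_0[OF subspace_homog[OF sc]])
  show "current_brkt L X Y \<in> homog (current L) (p + q)"
    unfolding current_brkt_homog[OF X XYv(2)] scaleR_scaleR[symmetric]
    by (intro subspace_sum[OF subspace_homog[OF sc]]) (rule subspace_scale[OF subspace_homog[OF sc] h])
  have "((-1) ^ ((card I + p) * card J) * gsign I J) *\<^sub>R axis (I \<union> J) (brkt L (X $ I) (Y $ J)) =
      - ((-1) ^ (p * q) *\<^sub>R ((-1) ^ ((card J + q) * card I) * gsign J I) *\<^sub>R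
        axis (J \<union> I) (brkt L (Y $ J) (X $ I)))" for I J
  proof -
    define a b c d e where "a = (-1::real) ^ ((card I + p) * card J)"
      and "b = (-1::real) ^ (card I * card J)" and "c = (-1::real) ^ ((card I + p) * (card J + q))"
      and "d = (-1::real) ^ (p * q)" and "e = (-1::real) ^ ((card J + q) * card I)"
    have "even ((card I + p) * card J + card I * card J + (card I + p) * (card J + q)) =
        even (p * q + (card J + q) * card I)"
      by (simp only: even_add even_mult_iff) blast
    then have "a * b * c = d * e"
      unfolding a_def b_def c_def d_def e_def power_add[symmetric] by (simp only: minus_one_power_iff)
    then have "a * (b * gsign J I) * c = d * (e * gsign J I)" by (metis mult.assoc mult.commute)
    then show ?thesis
      unfolding brkt_swap[OF x[of I] y[of J]] gsign_swap[of I J] a_def[symmetric] b_def[symmetric]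
        c_def[symmetric] d_def[symmetric] e_def[symmetric]
      by (simp only: axis_uminus axis_scale Un_commute[of I J] scaleR_minus_right scaleR_scaleR)
  qed
  then have "current_brkt L X Y = (\<Sum>I\<in>UNIV. \<Sum>J\<in>UNIV.
      - ((-1) ^ (p * q) *\<^sub>R ((-1) ^ ((card J + q) * card I) * gsign J I) *\<^sub>R
        axis (J \<union> I) (brkt L (Y $ J) (X $ I))))"
    unfolding current_brkt_homog[OF X XYv(2)] by simp
  also have "\<dots> = - ((-1) ^ (p * q) *\<^sub>R current_brkt L Y X)"
    unfolding current_brkt_homog[OF Y XYv(1)] scaleR_sum_right sum_negf[symmetric]
    by (rule sum.swap)
  finally show "current_brkt L X Y = - ((-1) ^ (p * q) *\<^sub>R current_brkt L Y X)" .
qed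

lemma current_super_skew_algebra:
  "super_skew_algebra (current L :: ('a ^ ('s::{finite,linorder} set)) superalgebra)"
  using current_super_skew superspace_current[OF superspace]
  by unfold_locales (simp_all add: current_def)

lemma brkt_current: "brkt (current L) = current_brkt L"
  by (simp add: current_def)

lemma current_brkt_axis_axis:
  assumes x: "x \<in> homog L p" and y: "y \<in> vecs L"
  shows "current_brkt L (axis I x) (axis J y :: 'a ^ ('s::{finite,linorder} set)) =
    ((-1) ^ (p * card J) * gsign I J) *\<^sub>R axis (I \<union> J) (brkt L x y)"
proof -
  have xp: "x \<in> homog L (card I + (card I + p))"
    using x homog_cong[of p "card I + (card I + p)" L] by (simp only: even_add) blast
  have z: "brkt L (axis I x $ I') (axis J y $ J') = (if I' = I \<and> J' = J then brkt L x y else 0)" for I' J'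
    using homog_in_vecs[OF x] y
    by (simp add: axis_def brkt_zero_left brkt_zero_right subspace_0[OF subspace_vecs[OF superspace]])
  have "current_brkt L (axis I x) (axis J y) = (\<Sum>I'\<in>(UNIV :: 's set set). \<Sum>J'\<in>(UNIV :: 's set set). if J' = J then if I' = I then
      ((-1) ^ ((card I + (card I + p)) * card J) * gsign I J) *\<^sub>R axis (I \<union> J) (brkt L x y) else 0 else 0)"
    unfolding current_brkt_homog[OF axis_homog_current[OF superspace xp] axis_vecs_current[OF superspace y]] z
    by (intro sum.cong refl) auto
  also have "\<dots> = ((-1) ^ ((card I + (card I + p)) * card J) * gsign I J) *\<^sub>R axis (I \<union> J) (brkt L x y)"
    by simp
  also have "(-1::real) ^ ((card I + (card I + p)) * card J) = (-1) ^ (p * card J)"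
    by (auto simp: minus_one_power_iff)
  finally show ?thesis .
qed

lemma current_brkt_empty:
  fixes X Y :: "'a ^ ('s::{finite,linorder} set)"
  assumes X: "X \<in> vecs (current L)" and Y: "Y \<in> vecs (current L)"
  shows "current_brkt L X Y $ {} = brkt L (X $ {}) (Y $ {})"
proof -
  have v: "X $ {} \<in> vecs L" "Y $ {} \<in> vecs L" using X Y by (simp_all add: vecs_current[OF superspace])
  have "current_brkt L X Y $ {} = (\<Sum>I\<in>(UNIV :: 's set set). \<Sum>J\<in>(UNIV :: 's set set). if J = {} then if I = {} then
      \<Sum>p<2. brkt L (component L p (X $ {})) (Y $ {}) else 0 else 0)"
    unfolding current_brkt_axis sum_component
    by (intro sum.cong refl) (auto simp: axis_def gsign_def)
  also have "\<dots> = (\<Sum>p<2. brkt L (component L p (X $ {})) (Y $ {}))"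
    by simp
  also have "\<dots> = brkt L (component L 0 (X $ {}) + component L 1 (X $ {})) (Y $ {})"
    using brkt_add_left[OF v(2) component_vecs[OF v(1)] component_vecs[OF v(1)]] by (simp add: numeral_2_eq_2)
  also have "\<dots> = brkt L (X $ {}) (Y $ {})"
    using component_add_component[OF superspace v(1), of 0] by simp
  finally show ?thesis .
qed

end

section \<open>Ideals of the current algebra of a simple Lie superalgebra\<close>

locale simple_lie_superalgebra =
  fixes k :: "'k::euclidean_space superalgebra"
  assumes lie: "lie_superalgebra k" and simple: "simple_lsa k"
begin

sublocale super_skew_algebra k
  using lie by unfold_locales (simp_all add: lie_superalgebra_def)

lemma jacobi:
  assumes "x \<in> homog k p" "y \<in> homog k q" "z \<in> vecs k"
  shows "brkt k (brkt k x y) z = brkt k x (brkt k y z) - (-1) ^ (p * q) *\<^sub>R brkt k y (brkt k x z)"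
  using lie[unfolded lie_superalgebra_def, THEN conjunct2, THEN conjunct2, rule_format, OF assms] .

lemma simple_ideal_full:
  assumes "lsa_ideal k I" "x \<in> I" "x \<noteq> 0"
  shows "I = vecs k"
  using simple assms by (auto simp: simple_lsa_def)

lemma nonabelian:
  obtains p x y where "x \<in> homog k p" "y \<in> vecs k" "brkt k x y \<noteq> 0"
proof -
  obtain x y where xy: "x \<in> vecs k" "y \<in> vecs k" "brkt k x y \<noteq> 0"
    using simple by (auto simp: simple_lsa_def)
  obtain x0 x1 where x: "x0 \<in> homog k 0" "x1 \<in> homog k 1" "x = x0 + x1" using xy(1) by (rule vecsE)
  have "brkt k x y = brkt k x0 y + brkt k x1 y"
    unfolding x(3) by (rule brkt_add_left[OF xy(2) x(1,2)[THEN homog_in_vecs]])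
  then have "brkt k x0 y \<noteq> 0 \<or> brkt k x1 y \<noteq> 0" using xy(3) by auto
  then show ?thesis using that[OF x(1) xy(2)] that[OF x(2) xy(2)] by blast
qed

lemma ideal_current_brkt:
  assumes "lsa_ideal (current k :: ('k ^ ('s::{finite,linorder} set)) superalgebra) J"
    "X \<in> vecs (current k)" "Y \<in> J"
  shows "current_brkt k X Y \<in> J"
  using lsa_ideal_brkt[OF assms] by (simp add: current_def)

lemma ideal_axis_brkt:
  fixes I J :: "'s::{finite,linorder} set"
  assumes U: "lsa_ideal (current k) U" and x: "x \<in> homog k p" and y: "y \<in> vecs k"
    and J: "axis J y \<in> U" and d: "I \<inter> J = {}"
  shows "axis (I \<union> J) (brkt k x y) \<in> U"
proof -
  let ?c = "(-1) ^ (p * card J) * gsign I J"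
  have "current_brkt k (axis I x) (axis J y) \<in> U"
    by (rule ideal_current_brkt[OF U axis_vecs_current[OF superspace homog_in_vecs[OF x]] J])
  then have "inverse ?c *\<^sub>R ?c *\<^sub>R axis (I \<union> J) (brkt k x y) \<in> U"
    unfolding current_brkt_axis_axis[OF x y] by (rule subspace_scale[OF lsa_ideal_subspace[OF U]])
  moreover have "?c \<noteq> 0" using gsign_nonzero[OF d] by simp
  ultimately show ?thesis unfolding scaleR_scaleR by (metis left_inverse scaleR_one)
qed

text \<open>
  The \<open>I\<close>-th coefficients of the pure tensors in an ideal of the current algebra form an ideal of
  \<open>k\<close>; by simplicity it is zero or everything, and the bracket with a complementary blade passes
  from \<open>I\<close> to any larger index set.
\<close>
lemma coefficient_ideal:
  fixes I :: "'s::{finite,linorder} set"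
  assumes U: "lsa_ideal (current k) U"
  shows "lsa_ideal k {x \<in> vecs k. axis I x \<in> U}"
proof (rule lsa_idealI)
  note sU = lsa_ideal_subspace[OF U] and sk = subspace_vecs[OF superspace]
  show "subspace {x \<in> vecs k. axis I x \<in> U}"
    using sU sk by (simp add: subspace_def axis_add axis_scale axis_zero)
  show "brkt k x y \<in> {x \<in> vecs k. axis I x \<in> U}"
    if x: "x \<in> homog k p" and y: "y \<in> {x \<in> vecs k. axis I x \<in> U}" for p x y
    using ideal_axis_brkt[OF U x, of y I "{}"] y brkt_vecs[OF homog_in_vecs[OF x]] by auto
  fix x assume x: "x \<in> {x \<in> vecs k. axis I x \<in> U}"
  then obtain x0 x1 where x01: "x0 \<in> homog k 0" "x1 \<in> homog k 1" "x = x0 + x1" by (auto elim: vecsE)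
  let ?C = "current k :: ('k ^ ('s set)) superalgebra"
  note sC = superspace_current[OF superspace]
  have h: "axis I x0 \<in> homog ?C (card I)" "axis I x1 \<in> homog ?C (Suc (card I))"
    using x01(1,2) homog_cong[of 0 "card I + card I" k] homog_cong[of 1 "card I + Suc (card I)" k]
    by (auto intro!: axis_homog_current[OF superspace])
  have "component ?C q (axis I x) = component ?C q (axis I x0) + component ?C q (axis I x1)" for q
    unfolding x01(3) axis_add
    by (rule linear_on_add[OF linear_on_component[OF sC] h[THEN homog_vecs[OF sC, THEN subsetD]]])
  then have "component ?C (card I) (axis I x) = axis I x0" "component ?C (Suc (card I)) (axis I x) = axis I x1"
    using component_homog[OF sC h(1)] component_homog[OF sC h(2)] by simp_all
  then have "axis I x0 \<in> U" "axis I x1 \<in> U"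
    using lsa_ideal_component[OF sC U, of "axis I x"] x by (metis (lifting) mem_Collect_eq)+
  then show "\<exists>x0 \<in> {x \<in> vecs k. axis I x \<in> U} \<inter> homog k 0.
      \<exists>x1 \<in> {x \<in> vecs k. axis I x \<in> U} \<inter> homog k 1. x = x0 + x1"
    using x01 homog_in_vecs[OF x01(1)] homog_in_vecs[OF x01(2)] by blast
qed

lemma coefficient_all:
  fixes I :: "'s::{finite,linorder} set"
  assumes U: "lsa_ideal (current k) U" and "x \<in> vecs k" "x \<noteq> 0" "axis I x \<in> U" and "y \<in> vecs k"
  shows "axis I y \<in> U"
  using simple_ideal_full[OF coefficient_ideal[OF U], of x I] assms by auto

lemma ideal_contains_current_plus:
  fixes U :: "('k ^ ('s::{finite,linorder} set)) set"
  assumes U: "lsa_ideal (current k) U"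
    and gen: "\<And>i :: 's. \<exists>x \<in> vecs k. x \<noteq> 0 \<and> axis {i} x \<in> U"
  shows "current_plus k \<subseteq> U"
proof
  fix X :: "'k ^ ('s set)" assume X: "X \<in> current_plus k"
  have Xv: "X $ I \<in> vecs k" for I using X by (simp add: current_plus_def vecs_current[OF superspace])
  have "axis I (X $ I) \<in> U" for I
  proof (cases "I = {}")
    case True
    then show ?thesis using X subspace_0[OF lsa_ideal_subspace[OF U]] by (simp add: current_plus_def axis_zero)
  next
    case False
    then obtain i where i: "i \<in> I" by blast
    obtain p x y where xy: "x \<in> homog k p" "y \<in> vecs k" "brkt k x y \<noteq> 0" by (rule nonabelian)
    have "axis {i} y \<in> U" using gen[of i] coefficient_all[OF U _ _ _ xy(2)] by blast
    from ideal_axis_brkt[OF U xy(1,2) this, of "I - {i}"]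
    have "axis I (brkt k x y) \<in> U" using i by (simp add: insert_absorb)
    then show ?thesis
      using coefficient_all[OF U brkt_vecs[OF homog_in_vecs[OF xy(1)] xy(2)] xy(3)] Xv by blast
  qed
  then show "X \<in> U"
    by (subst vec_eq_sum_axis) (rule subspace_sum[OF lsa_ideal_subspace[OF U]])
qed

lemma head_ideal:
  fixes U :: "('k ^ ('s::{finite,linorder} set)) set"
  assumes U: "lsa_ideal (current k) U"
  shows "lsa_ideal k ((\<lambda>X. X $ {}) ` U)"
proof (rule lsa_idealI)
  note sC = superspace_current[OF superspace]
  show "subspace ((\<lambda>X. X $ {}) ` U)"
    by (intro linear_subspace_image lsa_ideal_subspace[OF U] bounded_linear.linear[OF bounded_linear_vec_nth])
  show "brkt k x y \<in> (\<lambda>X. X $ {}) ` U" if x: "x \<in> homog k p" and y: "y \<in> (\<lambda>X. X $ {}) ` U" for p x y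
  proof -
    obtain Y where Y: "Y \<in> U" "y = Y $ {}" using y by blast
    note ax = axis_vecs_current[OF superspace homog_in_vecs[OF x], of "{}"]
    have "brkt k x y = current_brkt k (axis {} x) Y $ {}"
      using current_brkt_empty[OF ax, of Y] Y lsa_ideal_subset[OF U] by auto
    then show ?thesis using ideal_current_brkt[OF U ax Y(1)] by blast
  qed
  fix x assume "x \<in> (\<lambda>X. X $ {}) ` U"
  then obtain X where X: "X \<in> U" "x = X $ {}" by blast
  obtain X0 X1 where "X0 \<in> U" "X0 \<in> homog (current k) 0" "X1 \<in> U" "X1 \<in> homog (current k) 1" "X = X0 + X1"
    by (rule lsa_ideal_split[OF U X(1)])
  then have "X0 $ {} \<in> (\<lambda>X. X $ {}) ` U \<inter> homog k 0" "X1 $ {} \<in> (\<lambda>X. X $ {}) ` U \<inter> homog k 1"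
      "x = X0 $ {} + X1 $ {}"
    using X(2) by (auto simp: homog_current dest: spec[of _ "{}"])
  then show "\<exists>x0\<in>(\<lambda>X. X $ {}) ` U \<inter> homog k 0. \<exists>x1\<in>(\<lambda>X. X $ {}) ` U \<inter> homog k 1. x = x0 + x1"
    by blast
qed

text \<open>
  An ideal that is not contained in the nilpotent ideal \<open>current_plus k\<close> surjects onto \<open>k\<close>.
  Descending induction on the degree of \<open>I\<close> then puts all of \<open>I \<otimes> k\<close> into it: the bracket of
  \<open>I \<otimes> x\<close> with an element of the ideal with head \<open>y\<close> is \<open>I \<otimes> [x, y]\<close> up to terms of higher
  degree.
\<close>
lemma ideal_with_head_full:
  fixes U :: "('k ^ ('s::{finite,linorder} set)) set"
  assumes U: "lsa_ideal (current k) U" and X: "X \<in> U" "X $ {} \<noteq> 0"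
  shows "U = vecs (current k)"
proof -
  have head: "(\<lambda>X. X $ {}) ` U = vecs k"
    using simple_ideal_full[OF head_ideal[OF U]] X by blast
  have all: "\<forall>y\<in>vecs k. axis I y \<in> U" for I :: "'s set"
  proof (induction "card (- I)" arbitrary: I rule: less_induct)
    case less
    obtain p x y where xy: "x \<in> homog k p" "y \<in> vecs k" "brkt k x y \<noteq> 0" by (rule nonabelian)
    have "y \<in> (\<lambda>X. X $ {}) ` U" unfolding head by (rule xy(2))
    then obtain Y where Y: "Y \<in> U" "Y $ {} = y" by auto
    have YI: "Y $ K \<in> vecs k" for K
      using Y(1) lsa_ideal_subset[OF U] by (auto simp: vecs_current[OF superspace])
    let ?f = "\<lambda>K. current_brkt k (axis I x) (axis K (Y $ K))"
    note ax = axis_vecs_current[OF superspace homog_in_vecs[OF xy(1)], of I]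
    have "current_brkt k (axis I x) Y = (\<Sum>K\<in>UNIV. ?f K)"
      by (subst (1) vec_eq_sum_axis[of Y])
        (rule linear_on_sum[OF super_skew_linear_right[OF current_super_skew ax]
          subspace_vecs[OF superspace_current[OF superspace]] finite axis_vecs_current[OF superspace YI]])
    also have "\<dots> = ?f {} + (\<Sum>K\<in>UNIV - {{}}. ?f K)"
      by (rule sum.remove) auto
    also have "?f {} = axis I (brkt k x y)"
      using current_brkt_axis_axis[OF xy(1) YI, of I "{}" "{}"] Y(2) by (simp add: gsign_empty)
    finally have e: "axis I (brkt k x y) = current_brkt k (axis I x) Y - (\<Sum>K\<in>UNIV - {{}}. ?f K)"
      by simp
    have h: "?f K \<in> U" if "K \<in> UNIV - {{}}" for K
    proof (cases "I \<inter> K = {}")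
      case True
      then have "- (I \<union> K) \<subset> - I" using that by blast
      then have "card (- (I \<union> K)) < card (- I)" by (intro psubset_card_mono) auto
      from less[OF this] show ?thesis
        unfolding current_brkt_axis_axis[OF xy(1) YI]
        by (intro subspace_scale[OF lsa_ideal_subspace[OF U]])
          (use brkt_vecs[OF homog_in_vecs[OF xy(1)] YI] in blast)
    next
      case False
      then show ?thesis
        unfolding current_brkt_axis_axis[OF xy(1) YI]
        by (simp add: gsign_def subspace_0[OF lsa_ideal_subspace[OF U]])
    qed
    have "axis I (brkt k x y) \<in> U"
      unfolding e
      by (rule subspace_diff[OF lsa_ideal_subspace[OF U] ideal_current_brkt[OF U ax Y(1)]
        subspace_sum[OF lsa_ideal_subspace[OF U] h]])
    then show ?case
      using coefficient_all[OF U brkt_vecs[OF homog_in_vecs[OF xy(1)] xy(2)] xy(3)] by blast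
  qed
  show ?thesis
  proof
    show "U \<subseteq> vecs (current k)" by (rule lsa_ideal_subset[OF U])
    show "vecs (current k) \<subseteq> U"
    proof
      fix Z :: "'k ^ ('s set)" assume "Z \<in> vecs (current k)"
      then have "axis I (Z $ I) \<in> U" for I using all by (simp add: vecs_current[OF superspace])
      then show "Z \<in> U"
        by (subst vec_eq_sum_axis) (rule subspace_sum[OF lsa_ideal_subspace[OF U]])
    qed
  qed
qed

end

section \<open>Semidefinite invariant forms\<close>

context simple_lie_superalgebra
begin

lemma even_part_nonzero:
  obtains x where "x \<in> homog k 0" "x \<noteq> 0"
proof (rule ccontr)
  assume "\<not> thesis"
  then have z: "x = 0" if "x \<in> homog k 0" for x using that \<open>\<And>x. x \<in> homog k 0 \<Longrightarrow> x \<noteq> 0 \<Longrightarrow> thesis\<close> by blast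
  have o: "x \<in> homog k 1" if x: "x \<in> vecs k" for x
  proof -
    obtain x0 x1 where "x0 \<in> homog k 0" "x1 \<in> homog k 1" "x = x0 + x1" using x by (rule vecsE)
    then show ?thesis using z[of x0] by simp
  qed
  obtain p x y where xy: "x \<in> homog k p" "y \<in> vecs k" "brkt k x y \<noteq> 0" by (rule nonabelian)
  have "brkt k x y \<in> homog k (1 + 1)" by (rule brkt_homog[OF o[OF homog_in_vecs[OF xy(1)]] o[OF xy(2)]])
  then have "brkt k x y \<in> homog k 0" using homog_cong[of "1 + 1" 0 k] by simp
  then show False using z xy(3) by blast
qed

lemma brkt_odd_square:
  assumes x: "x \<in> homog k 1"
  shows "brkt k x (brkt k x x) = 0"
proof -
  have s: "brkt k x x \<in> homog k 0" using brkt_homog[OF x x] homog_cong[of "1 + 1" 0 k] by simp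
  have "brkt k (brkt k x x) x = 2 *\<^sub>R brkt k x (brkt k x x)"
    using jacobi[OF x x homog_in_vecs[OF x]] by (simp add: scaleR_2)
  moreover have "brkt k (brkt k x x) x = - brkt k x (brkt k x x)"
    using brkt_swap[OF s x] by simp
  moreover have "3 *\<^sub>R brkt k x (brkt k x x) = 2 *\<^sub>R brkt k x (brkt k x x) + brkt k x (brkt k x x)"
    using scaleR_add_left[of 2 1 "brkt k x (brkt k x x)"] by simp
  ultimately have "3 *\<^sub>R brkt k x (brkt k x x) = - brkt k x (brkt k x x) + brkt k x (brkt k x x)"
    by (simp only:)
  then have "3 *\<^sub>R brkt k x (brkt k x x) = 0" by simp
  then show ?thesis by simp
qed

text \<open>
  Otherwise, by polarization, the odd part would be an abelian ideal, hence all of \<open>k\<close>.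
\<close>
lemma odd_squares_nonzero:
  assumes odd: "odd_part k \<noteq> {0}"
  obtains x where "x \<in> homog k 1" "brkt k x x \<noteq> 0"
proof (rule ccontr)
  assume "\<not> thesis"
  then have z: "brkt k x x = 0" if "x \<in> homog k 1" for x
    using that \<open>\<And>x. x \<in> homog k 1 \<Longrightarrow> brkt k x x \<noteq> 0 \<Longrightarrow> thesis\<close> by blast
  have zz: "brkt k x y = 0" if x: "x \<in> homog k 1" and y: "y \<in> homog k 1" for x y
  proof -
    note v = homog_in_vecs[OF x] homog_in_vecs[OF y]
    have xy: "x + y \<in> homog k 1" by (rule subspace_add[OF subspace_homog[OF superspace] x y])
    have "brkt k (x + y) (x + y) = (brkt k x x + brkt k x y) + (brkt k y x + brkt k y y)"
      using brkt_add_left[OF homog_in_vecs[OF xy] v] brkt_add_right[OF v(1) v] brkt_add_right[OF v(2) v]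
      by simp
    then have "brkt k x y + brkt k y x = 0" using z[OF xy] z[OF x] z[OF y] by simp
    moreover have "brkt k x y = brkt k y x" using brkt_swap[OF x y] by simp
    ultimately have "2 *\<^sub>R brkt k x y = 0" by (simp add: scaleR_2)
    then show ?thesis by simp
  qed
  note s1 = subspace_homog[OF superspace, of 1] and s0 = subspace_homog[OF superspace, of 0]
  have I: "lsa_ideal k (homog k 1)"
  proof (rule lsa_idealI)
    show "\<exists>x0 \<in> homog k 1 \<inter> homog k 0. \<exists>x1 \<in> homog k 1 \<inter> homog k 1. x = x0 + x1"
      if "x \<in> homog k 1" for x
      using that subspace_0[OF s0] subspace_0[OF s1] by (intro bexI[of _ 0] bexI[of _ x]) auto
    show "brkt k x y \<in> homog k 1" if x: "x \<in> homog k p" and y: "y \<in> homog k 1" for p x y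
    proof (cases "even p")
      case True
      then show ?thesis using brkt_homog[OF x y] homog_cong[of "p + 1" 1 k] by simp
    next
      case False
      then have "x \<in> homog k 1" using x homog_cong[of p 1 k] by simp
      then show ?thesis using zz[OF _ y] subspace_0[OF s1] by simp
    qed
  qed (rule s1)
  obtain u where "u \<in> homog k 1" "u \<noteq> 0"
    using odd subspace_0[OF s1] by (auto simp: homog_def)
  then have full: "homog k 1 = vecs k" by (rule simple_ideal_full[OF I])
  obtain p x y where xy: "x \<in> homog k p" "y \<in> vecs k" "brkt k x y \<noteq> 0" by (rule nonabelian)
  have "x \<in> homog k 1" "y \<in> homog k 1" unfolding full using homog_in_vecs[OF xy(1)] xy(2) by auto
  then show False using zz xy(3) by blast
qed

text \<open>
  An invariant form that is positive semidefinite and nonzero on the even part is nondegenerate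
  there, since the homogeneous radicals \<open>R 0\<close> and \<open>R 1\<close> of the form on the two parts span an ideal.
  But for odd \<open>x\<close> the Jacobi identity makes \<open>[x, x]\<close> isotropic: \<open>\<kappa> [x, x] [x, x]\<close> is a multiple of
  \<open>\<kappa> x [x, [x, x]] = 0\<close>. Hence \<open>[x, x]\<close> would vanish for all odd \<open>x\<close>. The factors \<open>c p q\<close> leave
  room for the signs that the odd generator introduces into the invariance of the forms to which
  this is applied.
\<close>
lemma semidefinite_invariant_form_zero:
  fixes \<kappa> :: "'k \<Rightarrow> 'k \<Rightarrow> real" and c :: "nat \<Rightarrow> nat \<Rightarrow> real"
  assumes odd: "odd_part k \<noteq> {0}"
    and linl: "\<And>y. y \<in> vecs k \<Longrightarrow> linear_on (vecs k) (\<lambda>x. \<kappa> x y)"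
    and linr: "\<And>x. x \<in> vecs k \<Longrightarrow> linear_on (vecs k) (\<kappa> x)"
    and sym: "\<And>x y. x \<in> homog k 0 \<Longrightarrow> y \<in> homog k 0 \<Longrightarrow> \<kappa> x y = \<kappa> y x"
    and inv: "\<And>p q a w y. a \<in> homog k p \<Longrightarrow> w \<in> homog k q \<Longrightarrow> y \<in> vecs k \<Longrightarrow>
        \<kappa> (brkt k a w) y = c p q * \<kappa> w (brkt k a y)"
    and nonneg: "\<And>x. x \<in> homog k 0 \<Longrightarrow> \<kappa> x x \<ge> 0"
    and z: "z \<in> homog k 0"
  shows "\<kappa> z z = 0"
proof -
  define R where "R q = {w \<in> homog k q. \<forall>y\<in>homog k q. \<kappa> w y = 0}" for q
  have R_cong: "R p = R q" if "even p = even q" for p q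
    using homog_cong[OF that, of k] by (simp add: R_def)
  have sR: "subspace (R q)" for q
  proof (rule subspaceI)
    note sq = subspace_homog[OF superspace, of q]
    show "0 \<in> R q"
      using subspace_0[OF sq] linear_on_zero[OF linl subspace_0[OF subspace_vecs[OF superspace]]] homog_in_vecs
      unfolding R_def by blast
    show "x + y \<in> R q" if "x \<in> R q" "y \<in> R q" for x y
      using that subspace_add[OF sq] linear_on_add[OF linl, of _ x y] homog_in_vecs[of _ q]
      by (simp add: R_def)
    show "r *\<^sub>R x \<in> R q" if "x \<in> R q" for r x
      using that subspace_scale[OF sq] linear_on_scale[OF linl, of _ x r] homog_in_vecs[of _ q]
      by (simp add: R_def)
  qed
  define I where "I = {x + y |x y. x \<in> R 0 \<and> y \<in> R 1}"
  have RI: "R q \<subseteq> I" for q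
  proof -
    have "R 0 \<subseteq> I" using subspace_0[OF sR[of 1]] unfolding I_def by force
    moreover have "R 1 \<subseteq> I" using subspace_0[OF sR[of 0]] unfolding I_def by force
    ultimately show ?thesis using R_cong[of q 0] R_cong[of q 1] by (cases "even q") auto
  qed
  have I: "lsa_ideal k I"
  proof (rule lsa_idealI)
    show sI: "subspace I" unfolding I_def by (rule subspace_sums[OF sR sR])
    show split: "\<exists>x0 \<in> I \<inter> homog k 0. \<exists>x1 \<in> I \<inter> homog k 1. x = x0 + x1" if x: "x \<in> I" for x
    proof -
      obtain x0 x1 where "x0 \<in> R 0" "x1 \<in> R 1" "x = x0 + x1" using x unfolding I_def by blast
      moreover then have "x0 \<in> homog k 0" "x1 \<in> homog k 1" by (simp_all add: R_def)
      ultimately show ?thesis using RI by blast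
    qed
    fix p a w assume a: "a \<in> homog k p" and w: "w \<in> I"
    have h: "brkt k a v \<in> I" if v: "v \<in> R q" for v q
    proof -
      have vq: "v \<in> homog k q" using v by (simp add: R_def)
      have "\<kappa> (brkt k a v) y = 0" if y: "y \<in> homog k (p + q)" for y
      proof -
        have "homog k (p + (p + q)) = homog k q" by (rule homog_cong) (simp only: even_add, blast)
        then have "brkt k a y \<in> homog k q" using brkt_homog[OF a y] by blast
        then show ?thesis using inv[OF a vq homog_in_vecs[OF y]] v by (simp add: R_def)
      qed
      then have "brkt k a v \<in> R (p + q)" using brkt_homog[OF a vq] by (simp add: R_def)
      then show ?thesis using RI by blast
    qed
    obtain w0 w1 where w01: "w0 \<in> R 0" "w1 \<in> R 1" "w = w0 + w1" using w unfolding I_def by blast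
    have w: "w0 \<in> homog k 0" "w1 \<in> homog k 1" using w01 by (simp_all add: R_def)
    have "brkt k a w = brkt k a w0 + brkt k a w1"
      unfolding w01(3) by (rule brkt_add_right[OF homog_in_vecs[OF a] w[THEN homog_in_vecs]])
    then show "brkt k a w \<in> I" using h[OF w01(1)] h[OF w01(2)] subspace_add[OF sI] by simp
  qed
  \<comment> \<open>Isotropic vectors of a semidefinite form lie in its radical.\<close>
  have isotropic: "x \<in> R 0" if x: "x \<in> homog k 0" and xx: "\<kappa> x x = 0" for x
  proof -
    have "\<kappa> x y = 0" if y: "y \<in> homog k 0" for y
    proof (rule ccontr)
      assume n: "\<kappa> x y \<noteq> 0"
      \<comment> \<open>The value of \<open>t\<close> at which \<open>\<kappa> y y + 2 * t * \<kappa> x y\<close> equals \<open>-1\<close>.\<close>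
      define t where "t = - (\<kappa> y y + 1) / (2 * \<kappa> x y)"
      note v = homog_in_vecs[OF x] homog_in_vecs[OF y]
      have tx: "t *\<^sub>R x \<in> homog k 0" by (rule subspace_scale[OF subspace_homog[OF superspace] x])
      have yt: "y + t *\<^sub>R x \<in> homog k 0" by (rule subspace_add[OF subspace_homog[OF superspace] y tx])
      have "\<kappa> (y + t *\<^sub>R x) (y + t *\<^sub>R x) = (\<kappa> y y + t * \<kappa> y x) + t * (\<kappa> x y + t * \<kappa> x x)"
        using linear_on_add[OF linl[OF homog_in_vecs[OF yt]] v(2) homog_in_vecs[OF tx]]
          linear_on_scale[OF linl[OF homog_in_vecs[OF yt]] v(1), of t]
          linear_on_add[OF linr[OF v(2)] v(2) homog_in_vecs[OF tx]] linear_on_scale[OF linr[OF v(2)] v(1), of t]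
          linear_on_add[OF linr[OF v(1)] v(2) homog_in_vecs[OF tx]] linear_on_scale[OF linr[OF v(1)] v(1), of t]
        by simp
      also have "\<dots> = \<kappa> y y + t * (2 * \<kappa> x y)" using xx sym[OF x y] by (simp add: algebra_simps)
      also have "\<dots> = - 1" using n by (simp add: t_def)
      finally show False using nonneg[OF yt] by simp
    qed
    then show ?thesis using x by (simp add: R_def)
  qed
  show ?thesis
  proof (cases "I = {0}")
    case True
    obtain x where x: "x \<in> homog k 1" "brkt k x x \<noteq> 0" by (rule odd_squares_nonzero[OF odd])
    have s: "brkt k x x \<in> homog k 0" using brkt_homog[OF x(1) x(1)] homog_cong[of "1 + 1" 0 k] by simp
    have "\<kappa> (brkt k x x) (brkt k x x) = 0"
      using inv[OF x(1) x(1) homog_in_vecs[OF s]] brkt_odd_square[OF x(1)]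
        linear_on_zero[OF linr[OF homog_in_vecs[OF x(1)]] subspace_0[OF subspace_vecs[OF superspace]]]
      by simp
    then have "brkt k x x \<in> I" using isotropic[OF s] RI by blast
    then show ?thesis using True x(2) by simp
  next
    case False
    then have "I = vecs k" using simple I by (auto simp: simple_lsa_def)
    then obtain a b where ab: "a \<in> R 0" "b \<in> R 1" "z = a + b"
      using homog_in_vecs[OF z] unfolding I_def by blast
    have "z + 0 = a + b" using ab(3) by simp
    then have "z = a"
      using homog_sum_eq_iff[OF superspace z, of a 0 b] ab(1,2) subspace_0[OF subspace_homog[OF superspace, of 1]]
      by (simp add: R_def)
    then show ?thesis using ab(1) z by (simp add: R_def)
  qed
qed

end

section \<open>The unitary radical of a central extension of the current algebra\<close>

lemma homog_central_ext: "homog (central_ext L M \<omega>) p = homog L p \<times> homog M p"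
  by (simp add: homog_def central_ext_def)

lemma vecs_central_ext: "vecs (central_ext L M \<omega>) = vecs L \<times> vecs M"
proof
  show "vecs (central_ext L M \<omega>) \<subseteq> vecs L \<times> vecs M"
    by (auto elim!: vecsE simp: homog_central_ext intro!: vecsI)
  show "vecs L \<times> vecs M \<subseteq> vecs (central_ext L M \<omega>)"
  proof clarify
    fix x m assume "x \<in> vecs L" "m \<in> vecs M"
    then obtain x0 x1 m0 m1 where "x0 \<in> homog L 0" "x1 \<in> homog L 1" "x = x0 + x1"
      "m0 \<in> homog M 0" "m1 \<in> homog M 1" "m = m0 + m1" by (meson vecsE)
    then show "(x, m) \<in> vecs (central_ext L M \<omega>)"
      using vecsI[of "(x0, m0)" "central_ext L M \<omega>" "(x1, m1)"] by (simp add: homog_central_ext)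
  qed
qed

lemma brkt_central_ext: "brkt (central_ext L M \<omega>) (x, m) (y, n) = (brkt L x y, \<omega> x y)"
  by (simp add: central_ext_def)

lemma superspace_central_ext:
  assumes "superspace L" "superspace M"
  shows "superspace (central_ext L M \<omega>)"
  using assms unfolding superspace_def central_ext_def
  by (auto simp: zero_prod_def intro: subspace_Times)

lemma central_ext_super_skew_algebra:
  assumes L: "super_skew_algebra L" and M: "superspace M" and \<omega>: "super_skew L M \<omega>"
  shows "super_skew_algebra (central_ext L M \<omega>)"
proof -
  interpret super_skew_algebra L by (rule L)
  let ?E = "central_ext L M \<omega>"
  have "super_skew ?E ?E (brkt ?E)"
    unfolding super_skew_def
  proof (intro conjI ballI allI)
    fix z assume "z \<in> vecs ?E"
    then have z: "fst z \<in> vecs L" by (auto simp: vecs_central_ext)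
    show "linear_on (vecs ?E) (brkt ?E z)"
      using super_skew_linear_right[OF skew z] super_skew_linear_right[OF \<omega> z]
      by (cases z) (simp add: linear_on_def vecs_central_ext brkt_central_ext)
    show "linear_on (vecs ?E) (\<lambda>x. brkt ?E x z)"
      using super_skew_linear_left[OF skew z] super_skew_linear_left[OF \<omega> z]
      by (cases z) (simp add: linear_on_def vecs_central_ext brkt_central_ext)
  next
    fix p q x y assume x: "x \<in> homog ?E p" and y: "y \<in> homog ?E q"
    then have xy: "fst x \<in> homog L p" "fst y \<in> homog L q" by (auto simp: homog_central_ext)
    have b: "brkt ?E x y = (brkt L (fst x) (fst y), \<omega> (fst x) (fst y))" for x y
      by (simp add: central_ext_def split: prod.splits)
    show "brkt ?E x y \<in> homog ?E (p + q)"
      using brkt_homog[OF xy] super_skew_homog[OF \<omega> xy] by (simp add: b homog_central_ext)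
    show "brkt ?E x y = - ((-1) ^ (p * q) *\<^sub>R brkt ?E y x)"
      unfolding b brkt_swap[OF xy] super_skew_swap[OF \<omega> xy] by simp
  qed
  then show ?thesis using superspace_central_ext[OF superspace M] by (simp add: super_skew_algebra_def)
qed

lemma fst_ideal:
  assumes L: "super_skew_algebra L" and M: "superspace M" and U: "lsa_ideal (central_ext L M \<omega>) U"
  shows "lsa_ideal L (fst ` U)"
proof -
  interpret super_skew_algebra L by (rule L)
  show ?thesis
  proof (rule lsa_idealI)
    show "subspace (fst ` U)" by (rule linear_subspace_image[OF linear_fst lsa_ideal_subspace[OF U]])
    show "brkt L x y \<in> fst ` U" if x: "x \<in> homog L p" and y: "y \<in> fst ` U" for p x y
    proof -
      obtain n where n: "(y, n) \<in> U" using y by auto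
      have "(x, 0) \<in> vecs (central_ext L M \<omega>)"
        using homog_in_vecs[OF x] subspace_0[OF subspace_vecs[OF M]] by (simp add: vecs_central_ext)
      from lsa_ideal_brkt[OF U this n] show ?thesis by (force simp: brkt_central_ext)
    qed
    fix x assume "x \<in> fst ` U"
    then obtain u where u: "u \<in> U" "x = fst u" by blast
    obtain u0 u1 where u01: "u0 \<in> U" "u0 \<in> homog (central_ext L M \<omega>) 0"
        "u1 \<in> U" "u1 \<in> homog (central_ext L M \<omega>) 1" "u = u0 + u1"
      by (rule lsa_ideal_split[OF U u(1)])
    then have "fst u0 \<in> fst ` U \<inter> homog L 0" "fst u1 \<in> fst ` U \<inter> homog L 1" "x = fst u0 + fst u1"
      using u(2) by (auto simp: homog_central_ext)
    then show "\<exists>x0 \<in> fst ` U \<inter> homog L 0. \<exists>x1 \<in> fst ` U \<inter> homog L 1. x = x0 + x1" by blast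
  qed
qed

locale current_extension = simple_lie_superalgebra k
  for k :: "'k::euclidean_space superalgebra" +
  fixes M :: "'m::euclidean_space superspace"
    and \<omega> :: "'k ^ ('s::{finite,linorder} set) \<Rightarrow> 'k ^ ('s set) \<Rightarrow> 'm"
  assumes odd: "odd_part k \<noteq> {0}"
    and M: "superspace M" and cocycle: "two_cocycle (current k) M \<omega>"
begin

abbreviation g :: "('k ^ ('s set)) superalgebra" where "g \<equiv> current k"
abbreviation ghat :: "(('k ^ ('s set)) \<times> 'm) superalgebra" where "ghat \<equiv> central_ext g M \<omega>"

lemma omega_skew: "super_skew g M \<omega>"
  using cocycle unfolding two_cocycle_def by (rule conjunct1)

lemma omega_cocycle:
  assumes "x \<in> homog g p" "y \<in> homog g q" "z \<in> vecs g"
  shows "\<omega> (current_brkt k x y) z =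
    \<omega> x (current_brkt k y z) - (-1) ^ (p * q) *\<^sub>R \<omega> y (current_brkt k x z)"
  using cocycle[unfolded two_cocycle_def, THEN conjunct2, rule_format, OF assms] by (simp only: brkt_current)

lemma sg: "superspace g"
  by (rule superspace_current[OF superspace])

sublocale ext: super_skew_algebra ghat
  by (rule central_ext_super_skew_algebra[OF current_super_skew_algebra M omega_skew])

lemma axis_generator_homog: "x \<in> homog k q \<Longrightarrow> axis {i} x \<in> homog g (q + 1)"
  using homog_cong[of q "card {i} + (q + 1)" k] by (intro axis_homog_current[OF superspace]) simp

lemma generator_square: "x \<in> homog k q \<Longrightarrow> y \<in> vecs k \<Longrightarrow> current_brkt k (axis {i} x) (axis {i} y) = 0"
  by (simp add: current_brkt_axis_axis gsign_def)

text \<open>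
  Since a generator squares to zero, the cocycle identity reduces to invariance of the form that
  \<open>\<omega>\<close> induces on its coefficients; because of the odd generator, this form is symmetric on the
  even part.
\<close>
lemma generator_form_invariant:
  assumes a: "a \<in> homog k p" and w: "w \<in> homog k q" and y: "y \<in> vecs k"
  shows "\<omega> (axis {i} (brkt k a w)) (axis {i} y) =
    - ((-1) ^ (p * (q + 1)) *\<^sub>R \<omega> (axis {i} w) (axis {i} (brkt k a y)))"
proof -
  have ah: "axis {} a \<in> homog g p" using a by (intro axis_homog_current[OF superspace]) simp
  have av: "axis {} a \<in> vecs g" by (rule axis_vecs_current[OF superspace homog_in_vecs[OF a]])
  have v: "axis {i} x \<in> vecs g" if "x \<in> vecs k" for x by (rule axis_vecs_current[OF superspace that])
  have b: "current_brkt k (axis {} a) (axis {i} x) = (-1) ^ p *\<^sub>R axis {i} (brkt k a x)" if "x \<in> vecs k" for x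
    using current_brkt_axis_axis[OF a that, of "{}" "{i}"] by (simp add: gsign_empty)
  have "\<omega> (axis {} a) 0 = 0"
    by (rule linear_on_zero[OF super_skew_linear_right[OF omega_skew av] subspace_0[OF subspace_vecs[OF sg]]])
  then have "\<omega> ((-1) ^ p *\<^sub>R axis {i} (brkt k a w)) (axis {i} y) =
      - ((-1) ^ (p * (q + 1)) *\<^sub>R \<omega> (axis {i} w) ((-1) ^ p *\<^sub>R axis {i} (brkt k a y)))"
    using omega_cocycle[OF ah axis_generator_homog[OF w] v[OF y], of i]
    unfolding b[OF homog_in_vecs[OF w]] b[OF y] generator_square[OF w y] by simp
  then have "(-1) ^ p *\<^sub>R \<omega> (axis {i} (brkt k a w)) (axis {i} y) =
      - ((-1) ^ (p * (q + 1)) *\<^sub>R (-1) ^ p *\<^sub>R \<omega> (axis {i} w) (axis {i} (brkt k a y)))"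
    using super_skew_scale_left[OF omega_skew v[OF y] v[OF brkt_vecs[OF homog_in_vecs[OF a] homog_in_vecs[OF w]]]]
      super_skew_scale_right[OF omega_skew v[OF homog_in_vecs[OF w]] v[OF brkt_vecs[OF homog_in_vecs[OF a] y]]]
    by simp
  then show ?thesis by (cases "even p") (simp, simp, metis minus_minus)
qed

text \<open>
  For even \<open>x\<close> the square of \<open>\<epsilon> \<otimes> x\<close> in the extension is the central element \<open>\<omega> (\<epsilon> x) (\<epsilon> x)\<close>.
  A hyperplane separating its negative from the cone would turn \<open>\<omega>\<close> into a semidefinite
  invariant form that is nonzero at \<open>x\<close>.
\<close>
lemma generator_in_urad:
  fixes i :: 's
  assumes x: "x \<in> homog k 0"
  shows "(axis {i} x, 0) \<in> urad ghat"
proof -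
  let ?B = "\<lambda>x y. \<omega> (axis {i} x) (axis {i} y)"
  have v: "axis {i} y \<in> vecs g" if "y \<in> vecs k" for y by (rule axis_vecs_current[OF superspace that])
  have oddh: "(axis {i} y, 0) \<in> odd_part ghat" if "y \<in> homog k 0" for y
    using axis_generator_homog[OF that, of i] subspace_0[OF subspace_homog[OF M, of 1]]
      homog_central_ext[of g M \<omega> 1] by (simp add: homog_1[unfolded One_nat_def])
  have sq: "brkt ghat (axis {i} y, 0) (axis {i} y, 0) = (0, ?B y y)" if "y \<in> homog k 0" for y
    using generator_square[OF that homog_in_vecs[OF that]] by (simp add: brkt_central_ext brkt_current)
  have cone: "(0, ?B y y) \<in> sq_cone ghat" if "y \<in> homog k 0" for y
    using ext.square_in_sq_cone[OF oddh[OF that]] sq[OF that] by simp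
  have neg: "(0, - ?B x x) \<in> sq_cone ghat"
  proof (rule ccontr)
    assume "(0, - ?B x x) \<notin> sq_cone ghat"
    from separating_hyperplane_closed_point[OF ext.sq_cone_convex ext.sq_cone_closed this]
    obtain a b where ab: "a \<bullet> (0, - ?B x x) < b" "\<And>u. u \<in> sq_cone ghat \<Longrightarrow> a \<bullet> u > b" by blast
    have scale: "r *\<^sub>R u \<in> sq_cone ghat" if "u \<in> sq_cone ghat" "r \<ge> 0" for u r
      using ext.sq_cone_cone that by (simp add: cone_def)
    have b: "b < 0" using ab(2)[OF scale[OF cone[OF x], of 0]] by (simp add: zero_prod_def[symmetric])
    have pos: "a \<bullet> u \<ge> 0" if u: "u \<in> sq_cone ghat" for u
    proof (rule ccontr)
      assume n: "\<not> a \<bullet> u \<ge> 0"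
      have "a \<bullet> ((b / (a \<bullet> u)) *\<^sub>R u) = b" using n by simp
      then show False using ab(2)[OF scale[OF u, of "b / (a \<bullet> u)"]] n b by (simp add: divide_nonpos_neg)
    qed
    define \<kappa> where "\<kappa> y z = snd a \<bullet> ?B y z" for y z
    have "\<kappa> x x = 0"
    proof (rule semidefinite_invariant_form_zero[where \<kappa> = \<kappa> and c = "\<lambda>p q. - ((-1) ^ (p * (q + 1)))",
          OF odd _ _ _ _ _ x])
      show "linear_on (vecs k) (\<lambda>y. \<kappa> y z)" if "z \<in> vecs k" for z
        using super_skew_linear_left[OF omega_skew v[OF that]] v
        by (simp add: linear_on_def \<kappa>_def axis_add axis_scale inner_add_right)
      show "linear_on (vecs k) (\<kappa> z)" if "z \<in> vecs k" for z
        using super_skew_linear_right[OF omega_skew v[OF that]] v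
        by (simp add: linear_on_def \<kappa>_def axis_add axis_scale inner_add_right)
      show "\<kappa> y z = \<kappa> z y" if "y \<in> homog k 0" "z \<in> homog k 0" for y z
        using super_skew_swap[OF omega_skew axis_generator_homog[OF that(1)] axis_generator_homog[OF that(2)], of i i]
        by (simp add: \<kappa>_def)
      show "\<kappa> (brkt k u w) y = - ((-1) ^ (p * (q + 1))) * \<kappa> w (brkt k u y)"
        if "u \<in> homog k p" "w \<in> homog k q" "y \<in> vecs k" for p q u w y
        unfolding \<kappa>_def generator_form_invariant[OF that] by simp
      show "\<kappa> y y \<ge> 0" if "y \<in> homog k 0" for y
        using pos[OF cone[OF that]] by (cases a) (simp add: \<kappa>_def)
    qed
    then show False using ab(1) b by (cases a) (simp add: \<kappa>_def)
  qed
  have "(0 :: 'k ^ ('s set), ?B x x) = - (0, - ?B x x)" by simp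
  then have "(0, ?B x x) \<in> sq_cone_edge ghat"
    unfolding sq_cone_edge_def using cone[OF x] neg by blast
  then show ?thesis using ext.urad_contains[OF oddh[OF x]] sq[OF x] by simp
qed

lemma current_plus_subset_urad: "current_plus k \<subseteq> fst ` urad ghat"
proof (rule ideal_contains_current_plus)
  show "lsa_ideal g (fst ` urad ghat)"
    by (rule fst_ideal[OF current_super_skew_algebra M ext.urad_ideal])
  obtain x where x: "x \<in> homog k 0" "x \<noteq> 0" by (rule even_part_nonzero)
  show "\<exists>x\<in>vecs k. x \<noteq> 0 \<and> axis {i} x \<in> fst ` urad ghat" for i
    using x homog_in_vecs[OF x(1)] generator_in_urad[OF x(1), of i] by force
qed

text \<open>
  Central elements do not contribute to brackets, so an ideal that covers the base contains every
  bracket of the extension.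
\<close>
lemma ideal_onto_full:
  assumes perfect: "perfect_lsa ghat" and U: "lsa_ideal ghat U" and onto: "fst ` U = vecs g"
  shows "U = vecs ghat"
proof
  show "U \<subseteq> vecs ghat" by (rule lsa_ideal_subset[OF U])
  have "brkt ghat u w \<in> U" if u: "u \<in> vecs ghat" and w: "w \<in> vecs ghat" for u w
  proof -
    have "fst w \<in> fst ` U" unfolding onto using w by (auto simp: vecs_central_ext)
    then obtain w' where w': "w' \<in> U" "fst w' = fst w" by auto
    have "brkt ghat u w = brkt ghat u w'" using w'(2) by (cases u; cases w; cases w') (simp add: brkt_central_ext)
    then show ?thesis using lsa_ideal_brkt[OF U u w'(1)] by simp
  qed
  then have "span {brkt ghat u w |u w. u \<in> vecs ghat \<and> w \<in> vecs ghat} \<subseteq> U"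
    by (intro span_minimal lsa_ideal_subspace[OF U]) blast
  then show "vecs ghat \<subseteq> U" using perfect by (simp add: perfect_lsa_def)
qed

lemma fst_urad:
  assumes perfect: "perfect_lsa ghat" and proper: "urad ghat \<noteq> vecs ghat"
  shows "fst ` urad ghat = current_plus k"
proof
  show "current_plus k \<subseteq> fst ` urad ghat" by (rule current_plus_subset_urad)
  have J: "lsa_ideal g (fst ` urad ghat)"
    by (rule fst_ideal[OF current_super_skew_algebra M ext.urad_ideal])
  show "fst ` urad ghat \<subseteq> current_plus k"
  proof
    fix X assume X: "X \<in> fst ` urad ghat"
    have "X $ {} = 0"
      using ideal_with_head_full[OF J X] ideal_onto_full[OF perfect ext.urad_ideal] proper by blast
    then show "X \<in> current_plus k" using X lsa_ideal_subset[OF J] by (auto simp: current_plus_def)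
  qed
qed

end

section \<open>Splitting off the unitary radical\<close>

lemma (in simple_lie_superalgebra) current_plus_subspace:
  "subspace (current_plus k :: ('k ^ ('s::{finite,linorder} set)) set)"
  using subspace_vecs[OF superspace_current[OF superspace]]
  by (auto simp: subspace_def current_plus_def)

context current_extension
begin

definition head :: "'k ^ ('s set) \<Rightarrow> 'k ^ ('s set)" where
  "head X = axis {} (X $ {})"

lemma linear_head: "linear head"
  by (intro linearI) (simp_all add: head_def axis_add axis_scale)

lemma axis_homog: "x \<in> homog k p \<Longrightarrow> axis {} x \<in> homog g p"
  by (rule axis_homog_current[OF superspace]) simp

lemma axis_vecs: "x \<in> vecs k \<Longrightarrow> axis {} x \<in> vecs g"
  by (rule axis_vecs_current[OF superspace])

lemma head_homog: "X \<in> homog g p \<Longrightarrow> head X \<in> homog g p"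
  unfolding head_def by (rule axis_homog) (auto simp: homog_current dest: spec[of _ "{}"])

lemma tail_homog: "X \<in> homog g p \<Longrightarrow> X - head X \<in> homog g p"
  using subspace_diff[OF subspace_homog[OF sg]] head_homog by blast

lemma tail_current_plus: "X \<in> vecs g \<Longrightarrow> X - head X \<in> current_plus k"
  using axis_vecs[of "X $ {}"] subspace_diff[OF subspace_vecs[OF sg]]
  by (simp add: current_plus_def head_def vecs_current[OF superspace])

lemma current_plus_head: "X \<in> current_plus k \<Longrightarrow> head X = 0"
  by (simp add: current_plus_def head_def axis_zero)

lemma brkt_axis_empty:
  assumes x: "x \<in> vecs k" and y: "y \<in> vecs k"
  shows "current_brkt k (axis {} x) (axis {} y :: 'k ^ ('s set)) = axis {} (brkt k x y)"
proof -
  obtain x0 x1 where x01: "x0 \<in> homog k 0" "x1 \<in> homog k 1" "x = x0 + x1" using x by (rule vecsE)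
  note v = x01(1,2)[THEN homog_in_vecs]
  have h: "current_brkt k (axis {} u) (axis {} y :: 'k ^ ('s set)) = axis {} (brkt k u y)" if "u \<in> homog k p" for u p
    using current_brkt_axis_axis[OF that y, of "{}" "{}"] by (simp add: gsign_empty)
  show ?thesis
    using super_skew_add_left[OF current_super_skew axis_vecs[OF y] v[THEN axis_vecs]]
    unfolding x01(3) axis_add h[OF x01(1)] h[OF x01(2)] brkt_add_left[OF y v] by simp
qed

context
  fixes U
  assumes U: "lsa_ideal ghat U" and fstU: "fst ` U = current_plus k"
begin

lemma sU: "subspace U"
  by (rule lsa_ideal_subspace[OF U])

lemma U_homog_part:
  assumes X: "X \<in> homog g p" "X \<in> current_plus k"
  shows "X \<in> fst ` (U \<inter> homog ghat p)"
proof -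
  obtain u where u: "u \<in> U" "fst u = X" using X(2) unfolding fstU[symmetric] by blast
  have "component ghat p u \<in> U" by (rule lsa_ideal_component[OF ext.superspace U u(1)])
  moreover have uv: "u \<in> vecs ghat" using u(1) lsa_ideal_subset[OF U] by blast
  then have c: "component ghat q u \<in> homog ghat q" for q by (rule component_homog_in[OF ext.superspace])
  moreover have "fst (component ghat p u) = X"
  proof -
    let ?a = "fst (component ghat p u)" and ?b = "fst (component ghat (Suc p) u)"
    have ab: "?a \<in> homog g p" "?b \<in> homog g (Suc p)" using c[of p] c[of "Suc p"] by (simp_all add: homog_central_ext mem_Times_iff)
    have "X = ?a + ?b"
      using component_add_component[OF ext.superspace uv, of p] u(2) by (metis fst_add)
    then have "component g p X = component g p ?a + component g p ?b"
      using linear_on_add[OF linear_on_component[OF sg] ab[THEN homog_vecs[OF sg, THEN subsetD]]] by simp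
    then show ?thesis
      using component_homog[OF sg X(1), of p] component_homog[OF sg ab(1), of p]
        component_homog[OF sg ab(2), of p] by simp
  qed
  ultimately show ?thesis by force
qed

text \<open>
  The section \<open>X \<mapsto> (X, \<theta> X)\<close> is obtained by inverting the projection of the homogeneous parts of
  \<open>U\<close> onto \<open>current_plus k\<close>; on \<open>1 \<otimes> k\<close>, where the choice is free, \<open>\<theta>\<close> vanishes.
\<close>
lemma section_exists:
  obtains \<theta> where "linear \<theta>" "\<And>p X. X \<in> homog g p \<Longrightarrow> \<theta> X \<in> homog M p"
    "\<And>X. X \<in> current_plus k \<Longrightarrow> (X, \<theta> X) \<in> U" "\<And>x. \<theta> (axis {} x) = 0"
proof -
  have "\<exists>h. h ` UNIV \<subseteq> U \<inter> homog ghat p \<and> linear h \<and> (\<forall>v\<in>fst ` (U \<inter> homog ghat p). fst (h v) = v)" for p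
    by (rule linear_exists_right_inverse_on[OF linear_fst])
      (rule subspace_inter[OF sU subspace_homog[OF ext.superspace]])
  then have "\<forall>p. \<exists>h. h ` UNIV \<subseteq> U \<inter> homog ghat p \<and> linear h \<and>
      (\<forall>v\<in>fst ` (U \<inter> homog ghat p). fst (h v) = v)" ..
  from choice[OF this] obtain h where h': "\<forall>p. h p ` UNIV \<subseteq> U \<inter> homog ghat p \<and> linear (h p) \<and>
      (\<forall>v\<in>fst ` (U \<inter> homog ghat p). fst (h p v) = v)" ..
  have h: "\<And>p v. h p v \<in> U \<inter> homog ghat p" "\<And>p. linear (h p)"
      "\<And>p v. v \<in> fst ` (U \<inter> homog ghat p) \<Longrightarrow> fst (h p v) = v"
    using h' by blast+
  obtain f where f: "linear f" "\<And>X. X \<in> even_part g \<Longrightarrow> f X = h 0 X" "\<And>X. X \<in> odd_part g \<Longrightarrow> f X = h 1 X"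
    using linear_from_parts[OF sg h(2)[of 0] h(2)[of 1]] by blast
  define \<theta> where "\<theta> X = snd (f (X - head X))" for X
  have lt: "linear (\<lambda>X. X - head X)" by (intro linear_compose_sub linear_ident linear_head)
  have l: "linear \<theta>"
    unfolding \<theta>_def using linear_compose[OF linear_compose[OF lt f(1)] linear_snd] by (simp add: o_def)
  have fh: "f X \<in> U \<inter> homog ghat p \<and> fst (f X) = X"
    if X: "X \<in> homog g p" "X \<in> current_plus k" for p X
  proof (cases "even p")
    case True
    then have e: "homog ghat p = homog ghat 0" and "X \<in> homog g 0" using X(1) homog_cong[of p 0 ghat] homog_cong[of p 0 g] by simp_all
    then have "f X = h 0 X" using f(2) by (simp add: homog_0)
    then show ?thesis using h(1)[of 0 X] h(3)[of X 0] U_homog_part[OF X] unfolding e by simp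
  next
    case False
    then have e: "homog ghat p = homog ghat 1" and "X \<in> homog g 1" using X(1) homog_cong[of p 1 ghat] homog_cong[of p 1 g] by simp_all
    then have "f X = h 1 X" using f(3) unfolding homog_1 by blast
    then show ?thesis using h(1)[of 1 X] h(3)[of X 1] U_homog_part[OF X] unfolding e by simp
  qed
  have m: "\<theta> X \<in> homog M p" if "X \<in> homog g p" for p X
    using fh[OF tail_homog[OF that] tail_current_plus] homog_vecs[OF sg] that
    unfolding \<theta>_def by (auto simp: homog_central_ext mem_Times_iff)
  have c: "(X, \<theta> X) \<in> U" if X: "X \<in> current_plus k" for X
  proof -
    have "X \<in> vecs g" using X by (simp add: current_plus_def)
    then obtain X0 X1 where X01: "X0 \<in> homog g 0" "X1 \<in> homog g 1" "X = X0 + X1" by (rule vecsE)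
    have "X0 $ {} \<in> homog k 0" "X1 $ {} \<in> homog k 1" using X01(1,2) by (auto simp: homog_current dest: spec[of _ "{}"])
    moreover have "X0 $ {} + X1 $ {} = 0 + 0" using X unfolding X01(3) by (simp add: current_plus_def)
    ultimately have "X0 $ {} = 0" "X1 $ {} = 0"
      using homog_sum_eq_iff[OF superspace, of "X0 $ {}" 0 "X1 $ {}" 0]
        subspace_0[OF subspace_homog[OF superspace]] by blast+
    then have cp: "X0 \<in> current_plus k" "X1 \<in> current_plus k"
      using X01(1,2) homog_vecs[OF sg] by (auto simp: current_plus_def)
    have "(Y, \<theta> Y) \<in> U" if "Y \<in> homog g p" "Y \<in> current_plus k" for Y p
      using fh[OF that] current_plus_head[OF that(2)] unfolding \<theta>_def by (cases "f Y") auto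
    from this[OF X01(1) cp(1)] this[OF X01(2) cp(2)]
    have "(X0, \<theta> X0) + (X1, \<theta> X1) \<in> U" by (rule subspace_add[OF sU])
    then show ?thesis using linear_add[OF l] by (simp add: X01(3))
  qed
  have "\<theta> (axis {} x) = 0" for x using linear_0[OF f(1)] by (simp add: \<theta>_def head_def)
  then show ?thesis using that l m c by blast
qed

lemma direct_sum_section:
  "\<exists>\<sigma>. ext_section g M \<omega> \<sigma> \<and> is_direct_sum U (\<sigma> ` current_plus k) (central_part M \<inter> U)"
proof -
  obtain \<theta> where \<theta>: "linear \<theta>" "\<And>p X. X \<in> homog g p \<Longrightarrow> \<theta> X \<in> homog M p"
    "\<And>X. X \<in> current_plus k \<Longrightarrow> (X, \<theta> X) \<in> U" "\<And>x. \<theta> (axis {} x) = 0" using section_exists by blast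
  define \<sigma> where "\<sigma> X = (X, \<theta> X)" for X
  have "ext_section g M \<omega> \<sigma>"
    unfolding ext_section_def even_linear_def
    using \<theta>(2) linear_imp_linear_on[OF \<theta>(1), of "vecs g"]
    by (simp add: linear_on_def \<sigma>_def homog_central_ext)
  moreover have "is_direct_sum U (\<sigma> ` current_plus k) (central_part M \<inter> U)"
    unfolding is_direct_sum_def
  proof
    show "U = {u + v |u v. u \<in> \<sigma> ` current_plus k \<and> v \<in> central_part M \<inter> U}" (is "U = ?S")
    proof
      show "?S \<subseteq> U" using \<theta>(3) subspace_add[OF sU] by (auto simp: \<sigma>_def)
      show "U \<subseteq> ?S"
      proof
        fix w assume w: "w \<in> U"
        then have X: "fst w \<in> current_plus k" unfolding fstU[symmetric] by blast
        have d: "w - \<sigma> (fst w) \<in> U" unfolding \<sigma>_def by (rule subspace_diff[OF sU w \<theta>(3)[OF X]])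
        moreover have "fst (w - \<sigma> (fst w)) = 0" by (simp add: \<sigma>_def)
        moreover have "snd (w - \<sigma> (fst w)) \<in> vecs M"
          using subsetD[OF lsa_ideal_subset[OF U] d] unfolding vecs_central_ext mem_Times_iff by blast
        ultimately have "w - \<sigma> (fst w) \<in> central_part M \<inter> U"
          by (simp add: central_part_def mem_Times_iff)
        moreover have "w = \<sigma> (fst w) + (w - \<sigma> (fst w))" by simp
        ultimately show "w \<in> ?S" using X by blast
      qed
    qed
    show "\<sigma> ` current_plus k \<inter> (central_part M \<inter> U) = {0}"
    proof
      show "\<sigma> ` current_plus k \<inter> (central_part M \<inter> U) \<subseteq> {0}"
        using linear_0[OF \<theta>(1)] by (auto simp: \<sigma>_def central_part_def zero_prod_def)
      have "0 \<in> \<sigma> ` current_plus k"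
        using linear_0[OF \<theta>(1)] subspace_0[OF current_plus_subspace]
        by (intro image_eqI[of _ _ 0]) (simp_all add: \<sigma>_def zero_prod_def)
      then show "{0} \<subseteq> \<sigma> ` current_plus k \<inter> (central_part M \<inter> U)"
        using subspace_0[OF sU] subspace_0[OF subspace_vecs[OF M]]
        by (simp add: central_part_def zero_prod_def)
    qed
  qed
  ultimately show ?thesis by blast
qed

lemma central_projection_exists:
  obtains P where "linear P" "\<And>p m. m \<in> homog M p \<Longrightarrow> P m \<in> homog M p"
    "\<And>m. m \<in> vecs M \<Longrightarrow> (0, m - P m) \<in> U" "\<And>m. (0, m) \<in> U \<Longrightarrow> P m = 0"
proof -
  define R where "R p = {m \<in> homog M p. (0, m) \<in> U}" for p
  have sR: "subspace (R p)" for p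
  proof -
    have "(0, a + b) \<in> U" if "(0, a) \<in> U" "(0, b) \<in> U" for a b
      using subspace_add[OF sU that] by simp
    moreover have "(0, c *\<^sub>R a) \<in> U" if "(0, a) \<in> U" for a c
      using subspace_scale[OF sU that, of c] by simp
    ultimately show ?thesis
      using subspace_homog[OF M, of p] subspace_0[OF sU] by (simp add: subspace_def R_def zero_prod_def)
  qed
  obtain e0 where e0: "linear e0" "\<And>m. e0 m \<in> R 0" "\<And>m. m \<in> R 0 \<Longrightarrow> e0 m = m"
    using linear_projection_exists[OF sR[of 0]] by blast
  obtain e1 where e1: "linear e1" "\<And>m. e1 m \<in> R 1" "\<And>m. m \<in> R 1 \<Longrightarrow> e1 m = m"
    using linear_projection_exists[OF sR[of 1]] by blast
  obtain P where P: "linear P" "\<And>m. m \<in> even_part M \<Longrightarrow> P m = m - e0 m" "\<And>m. m \<in> odd_part M \<Longrightarrow> P m = m - e1 m"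
    using linear_from_parts[OF M linear_compose_sub[OF linear_ident e0(1)] linear_compose_sub[OF linear_ident e1(1)]]
    by blast
  have h0: "P m \<in> homog M 0 \<and> (0, m - P m) \<in> U" if "m \<in> homog M 0" for m
    using P(2)[of m] e0(2)[of m] that subspace_diff[OF subspace_homog[OF M] that] by (simp add: R_def homog_0)
  have h1: "P m \<in> homog M 1 \<and> (0, m - P m) \<in> U" if "m \<in> homog M 1" for m
    using P(3)[of m] e1(2)[of m] that subspace_diff[OF subspace_homog[OF M] that] unfolding R_def homog_1 by simp
  have "P m \<in> homog M p" if "m \<in> homog M p" for p m
    using h0[of m] h1[of m] that homog_cong[of p 0 M] homog_cong[of p 1 M] by (cases "even p") auto
  moreover have "(0, m - P m) \<in> U" if mv: "m \<in> vecs M" for m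
  proof -
    obtain m0 m1 where m: "m0 \<in> homog M 0" "m1 \<in> homog M 1" "m = m0 + m1" using mv by (rule vecsE)
    have "(0, m0 - P m0) + (0, m1 - P m1) \<in> U" using h0[OF m(1)] h1[OF m(2)] subspace_add[OF sU] by blast
    then show ?thesis unfolding m(3) linear_add[OF P(1)] by (simp add: algebra_simps)
  qed
  moreover have "P m = 0" if m: "(0, m) \<in> U" for m
  proof -
    obtain u0 u1 where u: "u0 \<in> U" "u0 \<in> homog ghat 0" "u1 \<in> U" "u1 \<in> homog ghat 1" "(0, m) = u0 + u1"
      by (rule lsa_ideal_split[OF U m])
    obtain X0 m0 X1 m1 where uu: "u0 = (X0, m0)" "u1 = (X1, m1)" by (metis surj_pair)
    have X: "X0 \<in> homog g 0" "X1 \<in> homog g 1" "m0 \<in> homog M 0" "m1 \<in> homog M 1"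
      using u(2,4) by (auto simp: uu homog_central_ext)
    have "X0 + X1 = 0 + 0" using u(5) by (simp add: uu)
    then have "X0 = 0" "X1 = 0"
      using homog_sum_eq_iff[OF sg X(1) _ X(2), of 0 0] subspace_0[OF subspace_homog[OF sg]] by blast+
    then have "m0 \<in> R 0" "m1 \<in> R 1" using u(1,3) X(3,4) by (simp_all add: R_def uu)
    then have "P m0 = 0" "P m1 = 0" using P(2)[of m0] P(3)[of m1] e0(3) e1(3) X(3,4) unfolding homog_0 homog_1 by simp_all
    then show ?thesis using u(5) linear_add[OF P(1), of m0 m1] by (simp add: uu)
  qed
  ultimately show ?thesis using that P(1) by blast
qed

text \<open>
  A graded complement \<open>N\<close> of the central part of \<open>U\<close> in \<open>M\<close> is the kernel of the map from the
  quotient by \<open>U\<close> onto \<open>k\<close>. So the quotient is a central extension of \<open>k\<close> by \<open>N\<close>, with the restriction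
  of \<open>\<omega>\<close> to \<open>1 \<otimes> k\<close>, projected to \<open>N\<close>, as its cocycle. The map \<open>\<iota>\<close> lifts the quotient linearly; it is
  a homomorphism only modulo \<open>U\<close>.
\<close>
lemma quotient_central_ext:
  obtains N :: "'m superspace" and \<eta> \<pi> \<iota>
  where "superspace N" "two_cocycle k N \<eta>" "lsa_hom ghat (central_ext k N \<eta>) \<pi>"
    "\<pi> ` vecs ghat = vecs (central_ext k N \<eta>)"
    "linear \<iota>" "\<And>p z. z \<in> homog (central_ext k N \<eta>) p \<Longrightarrow> \<iota> z \<in> homog ghat p"
    "\<And>x y. x \<in> vecs (central_ext k N \<eta>) \<Longrightarrow> y \<in> vecs (central_ext k N \<eta>) \<Longrightarrow>
        brkt ghat (\<iota> x) (\<iota> y) - \<iota> (brkt (central_ext k N \<eta>) x y) \<in> U"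
    "\<And>X. X \<in> vecs ghat \<Longrightarrow> X - \<iota> (\<pi> X) \<in> U"
proof -
  obtain \<theta> where \<theta>: "linear \<theta>" "\<And>p X. X \<in> homog g p \<Longrightarrow> \<theta> X \<in> homog M p"
    "\<And>X. X \<in> current_plus k \<Longrightarrow> (X, \<theta> X) \<in> U" "\<And>x. \<theta> (axis {} x) = 0" using section_exists by blast
  obtain P where P: "linear P" "\<And>p m. m \<in> homog M p \<Longrightarrow> P m \<in> homog M p"
    "\<And>m. m \<in> vecs M \<Longrightarrow> (0, m - P m) \<in> U" "\<And>m. (0, m) \<in> U \<Longrightarrow> P m = 0" using central_projection_exists by blast
  define N :: "'m superspace" where "N = \<lparr>even_part = P ` even_part M, odd_part = P ` odd_part M\<rparr>"
  define \<eta> where "\<eta> x y = P (\<omega> (axis {} x) (axis {} y))" for x y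
  define \<pi> where "\<pi> z = (fst z $ {}, P (snd z - \<theta> (fst z)))" for z
  define \<iota> where "\<iota> z = (axis {} (fst z) :: 'k ^ ('s set), snd z)" for z :: "'k \<times> 'm"
  let ?K = "central_ext k N \<eta>"
  have hN: "homog N p = P ` homog M p" for p by (simp add: N_def homog_def)
  have hNM: "homog N p \<subseteq> homog M p" for p unfolding hN using P(2) by blast
  have N: "superspace N"
  proof -
    have "subspace (homog N p)" for p
      unfolding hN by (rule linear_subspace_image[OF P(1) subspace_homog[OF M]])
    from this[of 0] this[of 1] have s: "subspace (even_part N)" "subspace (odd_part N)"
      unfolding homog_0 homog_1 by auto
    have "even_part N \<subseteq> even_part M" "odd_part N \<subseteq> odd_part M"
      using hNM[of 0] hNM[of 1] unfolding homog_0 homog_1 by auto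
    then have "even_part N \<inter> odd_part N \<subseteq> {0}" using M unfolding superspace_def by blast
    then show ?thesis using s subspace_0 unfolding superspace_def by blast
  qed
  have vN: "vecs N = P ` vecs M"
  proof
    show "vecs N \<subseteq> P ` vecs M"
    proof
      fix n assume "n \<in> vecs N"
      then obtain n0 n1 where "n0 \<in> homog N 0" "n1 \<in> homog N 1" "n = n0 + n1" by (rule vecsE)
      then obtain m0 m1 where "m0 \<in> homog M 0" "m1 \<in> homog M 1" "n = P m0 + P m1" unfolding hN by blast
      then show "n \<in> P ` vecs M" using vecsI[of m0 M m1] by (metis linear_add[OF P(1)] imageI)
    qed
    show "P ` vecs M \<subseteq> vecs N"
    proof
      fix n assume "n \<in> P ` vecs M"
      then obtain m where "m \<in> vecs M" "n = P m" by blast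
      moreover then obtain m0 m1 where "m0 \<in> homog M 0" "m1 \<in> homog M 1" "m = m0 + m1" by (auto elim: vecsE)
      ultimately show "n \<in> vecs N" using vecsI[of "P m0" N "P m1"] by (simp add: hN linear_add[OF P(1)])
    qed
  qed
  have PP: "P (P m) = P m" if "m \<in> vecs M" for m
    using P(4)[OF P(3)[OF that]] linear_diff[OF P(1), of m "P m"] by simp
  have vNM: "vecs N \<subseteq> vecs M"
    using hNM[of 0] hNM[of 1] by (auto elim!: vecsE intro!: vecsI)
  have PN: "P n = n" if "n \<in> vecs N" for n
    using that PP unfolding vN by auto
  have \<eta>: "super_skew k N \<eta>"
    unfolding super_skew_def
  proof (intro conjI ballI allI)
    fix x assume x: "x \<in> vecs k"
    show "linear_on (vecs k) (\<eta> x)"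
      using super_skew_linear_right[OF omega_skew axis_vecs[OF x]] axis_vecs
      by (simp add: linear_on_def \<eta>_def axis_lincomb linear_add[OF P(1)] linear_scale[OF P(1)])
    show "linear_on (vecs k) (\<lambda>y. \<eta> y x)"
      using super_skew_linear_left[OF omega_skew axis_vecs[OF x]] axis_vecs
      by (simp add: linear_on_def \<eta>_def axis_lincomb linear_add[OF P(1)] linear_scale[OF P(1)])
  next
    fix p q x y assume xy: "x \<in> homog k p" "y \<in> homog k q"
    show "\<eta> x y \<in> homog N (p + q)"
      unfolding \<eta>_def hN by (rule imageI[OF super_skew_homog[OF omega_skew xy[THEN axis_homog]]])
    show "\<eta> x y = - ((-1) ^ (p * q) *\<^sub>R \<eta> y x)"
      unfolding \<eta>_def super_skew_swap[OF omega_skew xy[THEN axis_homog]]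
      by (simp only: linear_neg[OF P(1)] linear_scale[OF P(1)])
  qed
  have coc: "two_cocycle k N \<eta>"
    unfolding two_cocycle_def
  proof (intro conjI ballI allI)
    fix p q x y z assume h: "x \<in> homog k p" "y \<in> homog k q" "z \<in> vecs k"
    note v = h(1,2)[THEN homog_in_vecs]
    show "\<eta> (brkt k x y) z = \<eta> x (brkt k y z) - (-1) ^ (p * q) *\<^sub>R \<eta> y (brkt k x z)"
      using omega_cocycle[OF h(1,2)[THEN axis_homog] axis_vecs[OF h(3)]]
      unfolding brkt_axis_empty[OF v] brkt_axis_empty[OF v(1) h(3)] brkt_axis_empty[OF v(2) h(3)]
      by (simp add: \<eta>_def linear_diff[OF P(1)] linear_scale[OF P(1)])
  qed (rule \<eta>)
  have wv: "\<omega> X Y \<in> vecs M" if "X \<in> vecs g" "Y \<in> vecs g" for X Y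
    by (rule super_skew_vecs[OF omega_skew sg M that])
  have \<theta>v: "\<theta> X \<in> vecs M" if Xv: "X \<in> vecs g" for X
  proof -
    obtain X0 X1 where "X0 \<in> homog g 0" "X1 \<in> homog g 1" "X = X0 + X1" using Xv by (rule vecsE)
    then show ?thesis using \<theta>(2) vecsI[of "\<theta> X0" M "\<theta> X1"] by (simp add: linear_add[OF \<theta>(1)])
  qed
  \<comment> \<open>The cocycle adapted to the section, read modulo \<open>U\<close>, vanishes as soon as one argument lies
    in \<open>current_plus k\<close>; hence it only depends on the heads, where \<open>\<theta>\<close> is zero.\<close>
  define D where "D X Y = P (\<omega> X Y - \<theta> (current_brkt k X Y))" for X Y
  have DU: "D X Y = 0" if u: "(current_brkt k X Y, \<omega> X Y) \<in> U" for X Y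
  proof -
    have "current_brkt k X Y \<in> current_plus k" unfolding fstU[symmetric] using u by force
    from subspace_diff[OF sU u \<theta>(3)[OF this]] have "(0, \<omega> X Y - \<theta> (current_brkt k X Y)) \<in> U" by simp
    then show ?thesis unfolding D_def by (rule P(4))
  qed
  have D0: "D X Y = 0" "D Y X = 0" if X: "X \<in> current_plus k" and Y: "Y \<in> vecs g" for X Y
  proof -
    have Yv: "(Y, 0) \<in> vecs ghat" using Y subspace_0[OF subspace_vecs[OF M]] by (simp add: vecs_central_ext)
    show "D X Y = 0"
      using ext.lsa_ideal_brkt_right[OF U \<theta>(3)[OF X] Yv] by (intro DU) (simp add: brkt_central_ext brkt_current)
    show "D Y X = 0"
      using lsa_ideal_brkt[OF U Yv \<theta>(3)[OF X]] by (intro DU) (simp add: brkt_central_ext brkt_current)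
  qed
  have D: "D X Y = \<eta> (X $ {}) (Y $ {})" if X: "X \<in> vecs g" and Y: "Y \<in> vecs g" for X Y
  proof -
    have hv: "head Z \<in> vecs g" "Z - head Z \<in> vecs g" if "Z \<in> vecs g" for Z
      using tail_current_plus[OF that] axis_vecs[of "Z $ {}"] that
      by (auto simp: current_plus_def head_def vecs_current[OF superspace])
    have "D (head X + (X - head X)) Y = D (head X) Y + D (X - head X) Y"
      unfolding D_def super_skew_add_left[OF omega_skew Y hv[OF X]] super_skew_add_left[OF current_super_skew Y hv[OF X]]
      by (simp add: linear_add[OF \<theta>(1)] linear_diff[OF P(1)] linear_add[OF P(1)])
    then have 1: "D X Y = D (head X) Y" using D0(1)[OF tail_current_plus[OF X] Y] by simp
    have "D (head X) (head Y + (Y - head Y)) = D (head X) (head Y) + D (head X) (Y - head Y)"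
      unfolding D_def super_skew_add_right[OF omega_skew hv(1)[OF X] hv[OF Y]]
        super_skew_add_right[OF current_super_skew hv(1)[OF X] hv[OF Y]]
      by (simp add: linear_add[OF \<theta>(1)] linear_diff[OF P(1)] linear_add[OF P(1)])
    then have 2: "D X Y = D (head X) (head Y)" using 1 D0(2)[OF tail_current_plus[OF Y] hv(1)[OF X]] by simp
    have "X $ {} \<in> vecs k" "Y $ {} \<in> vecs k" using X Y by (simp_all add: vecs_current[OF superspace])
    then have "current_brkt k (head X) (head Y) = axis {} (brkt k (X $ {}) (Y $ {}))"
      unfolding head_def by (rule brkt_axis_empty)
    then show ?thesis unfolding 2 unfolding D_def by (simp add: \<theta>(4) \<eta>_def head_def)
  qed
  have \<pi>lin: "linear \<pi>"
    by (intro linearI) (simp_all add: \<pi>_def linear_add[OF P(1)] linear_add[OF \<theta>(1)] linear_diff[OF P(1)]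
        linear_scale[OF P(1)] linear_scale[OF \<theta>(1)] scaleR_diff_right[symmetric])
  have hom: "lsa_hom ghat ?K \<pi>"
    unfolding lsa_hom_def even_linear_def
  proof (intro conjI ballI allI)
    show "linear_on (vecs ghat) \<pi>" by (rule linear_imp_linear_on[OF \<pi>lin])
    fix p z assume z: "z \<in> homog ghat p"
    then have "fst z \<in> homog g p" "snd z \<in> homog M p" by (auto simp: homog_central_ext)
    then show "\<pi> z \<in> homog ?K p"
      using \<theta>(2) subspace_diff[OF subspace_homog[OF M]]
      by (auto simp: \<pi>_def homog_central_ext hN homog_current dest: spec[of _ "{}"])
  next
    fix x y assume "x \<in> vecs ghat" "y \<in> vecs ghat"
    moreover obtain X m Y n where xy: "x = (X, m)" "y = (Y, n)" by (metis surj_pair)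
    ultimately have XY: "X \<in> vecs g" "Y \<in> vecs g" by (auto simp: vecs_central_ext)
    show "\<pi> (brkt ghat x y) = brkt ?K (\<pi> x) (\<pi> y)"
      using D[OF XY] current_brkt_empty[OF XY] by (simp add: xy \<pi>_def D_def brkt_central_ext brkt_current)
  qed
  have \<iota>v: "\<iota> z \<in> vecs ghat" if "z \<in> vecs ?K" for z
    using that axis_vecs vNM by (auto simp: \<iota>_def vecs_central_ext)
  have \<pi>v: "\<pi> z \<in> vecs ?K" if "z \<in> vecs ghat" for z
    using that \<theta>v subspace_diff[OF subspace_vecs[OF M]]
    by (auto simp: \<pi>_def vecs_central_ext vN vecs_current[OF superspace])
  have \<pi>\<iota>: "\<pi> (\<iota> z) = z" if "z \<in> vecs ?K" for z
    using that PN by (auto simp: \<pi>_def \<iota>_def \<theta>(4) vecs_central_ext)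
  have surj: "\<pi> ` vecs ghat = vecs ?K"
  proof
    show "\<pi> ` vecs ghat \<subseteq> vecs ?K" using \<pi>v by blast
    show "vecs ?K \<subseteq> \<pi> ` vecs ghat" using \<pi>\<iota> \<iota>v by (metis imageI subsetI)
  qed
  have \<iota>lin: "linear \<iota>"
    by (intro linearI) (simp_all add: \<iota>_def axis_add axis_scale)
  have \<iota>h: "\<iota> z \<in> homog ghat p" if "z \<in> homog ?K p" for p z
    using that axis_homog subsetD[OF hNM] by (auto simp: \<iota>_def homog_central_ext)
  have \<iota>b: "brkt ghat (\<iota> x) (\<iota> y) - \<iota> (brkt ?K x y) \<in> U" if xy: "x \<in> vecs ?K" "y \<in> vecs ?K" for x y
  proof -
    have v: "fst x \<in> vecs k" "fst y \<in> vecs k" using xy by (auto simp: vecs_central_ext)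
    have "brkt ghat (\<iota> x) (\<iota> y) - \<iota> (brkt ?K x y) =
        (0, \<omega> (axis {} (fst x)) (axis {} (fst y)) - P (\<omega> (axis {} (fst x)) (axis {} (fst y))))"
      using brkt_axis_empty[OF v] by (cases x; cases y) (simp add: \<iota>_def brkt_central_ext brkt_current \<eta>_def)
    then show ?thesis using P(3)[OF wv[OF v[THEN axis_vecs]]] by simp
  qed
  have ker: "z - \<iota> (\<pi> z) \<in> U" if z: "z \<in> vecs ghat" for z
  proof -
    obtain X m where zz: "z = (X, m)" by (metis surj_pair)
    have X: "X \<in> vecs g" and m: "m \<in> vecs M" using z by (auto simp: zz vecs_central_ext)
    have "\<theta> (X - head X) = \<theta> X" using \<theta>(4) by (simp add: linear_diff[OF \<theta>(1)] head_def)
    then have "z - \<iota> (\<pi> z) = (X - head X, \<theta> (X - head X)) + (0, (m - \<theta> X) - P (m - \<theta> X))"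
      by (simp add: zz \<pi>_def \<iota>_def head_def)
    then show ?thesis
      using subspace_add[OF sU \<theta>(3)[OF tail_current_plus[OF X]]
          P(3)[OF subspace_diff[OF subspace_vecs[OF M] m \<theta>v[OF X]]]] by simp
  qed
  show ?thesis by (rule that[OF N coc hom surj \<iota>lin \<iota>h \<iota>b ker])
qed

end

end

text \<open>
  Lifting elements of the quotient along a linear section changes neither linearity nor
  adjointness, and brackets only by elements on which the representation vanishes.
\<close>
lemma unitary_rep_descends:
  fixes E :: "'a::euclidean_space superalgebra" and Q :: "'b::euclidean_space superalgebra"
    and H :: "'h::ab_group_add prehilbert"
  assumes E: "super_skew_algebra E" and Q: "superspace Q" and rep: "unitary_rep E H \<rho>"
    and QB: "\<And>x y. x \<in> vecs Q \<Longrightarrow> y \<in> vecs Q \<Longrightarrow> brkt Q x y \<in> vecs Q"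
    and \<pi>: "\<pi> ` vecs E = vecs Q" and \<iota>: "linear \<iota>" "\<And>p z. z \<in> homog Q p \<Longrightarrow> \<iota> z \<in> homog E p"
    and br: "\<And>x y. x \<in> vecs Q \<Longrightarrow> y \<in> vecs Q \<Longrightarrow> brkt E (\<iota> x) (\<iota> y) - \<iota> (brkt Q x y) \<in> urad E"
    and ker: "\<And>X. X \<in> vecs E \<Longrightarrow> X - \<iota> (\<pi> X) \<in> urad E"
  shows "factors_via E Q \<pi> H \<rho>"
proof -
  interpret unitary_representation E H \<rho>
    using E rep by (simp add: unitary_representation_def unitary_representation_axioms_def)
  have \<iota>v: "\<iota> z \<in> vecs E" if zv: "z \<in> vecs Q" for z
  proof -
    obtain z0 z1 where "z0 \<in> homog Q 0" "z1 \<in> homog Q 1" "z = z0 + z1" using zv by (rule vecsE)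
    then show ?thesis using \<iota>(2) vecsI[of "\<iota> z0" E "\<iota> z1"] by (simp add: linear_add[OF \<iota>(1)])
  qed
  have eq: "\<rho> X v = \<rho> Y v" if "X - Y \<in> urad E" "Y \<in> vecs E" "v \<in> vecs H" for X Y v
  proof -
    have k: "X - Y \<in> rep_kernel" using that(1) urad_subset_rep_kernel by blast
    have "\<rho> ((X - Y) + Y) v = \<rho> (X - Y) v + \<rho> Y v"
      by (rule rho_add_left[OF _ that(2,3)]) (use k in \<open>simp add: rep_kernel_def\<close>)
    then show ?thesis using k that(3) by (simp add: rep_kernel_def)
  qed
  have "unitary_rep Q H (\<lambda>z. \<rho> (\<iota> z))"
    unfolding unitary_rep_def
  proof (intro conjI ballI allI impI)
    show "prehilbert_superspace H" using rep by (simp add: unitary_rep_def)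
    show "\<rho> (\<iota> X) (scaleH H a u + scaleH H b v) = scaleH H a (\<rho> (\<iota> X) u) + scaleH H b (\<rho> (\<iota> X) v)"
      if "X \<in> vecs Q" "u \<in> vecs H" "v \<in> vecs H" for X u v a b
      by (rule rho_lincomb_right[OF \<iota>v[OF that(1)] that(2,3)])
    show "\<rho> (\<iota> (a *\<^sub>R X + b *\<^sub>R Y)) v =
        scaleH H (of_real a) (\<rho> (\<iota> X) v) + scaleH H (of_real b) (\<rho> (\<iota> Y) v)"
      if "X \<in> vecs Q" "Y \<in> vecs Q" "v \<in> vecs H" for X Y v and a b :: real
      unfolding linear_add[OF \<iota>(1)] linear_scale[OF \<iota>(1)]
      by (rule rho_lincomb_left[OF \<iota>v[OF that(1)] \<iota>v[OF that(2)] that(3)])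
    show "\<rho> (\<iota> X) v \<in> homog H (p + q)" if "X \<in> homog Q p" "v \<in> homog H q" for p q X v
      by (rule rho_homog[OF \<iota>(2)[OF that(1)] that(2)])
    show "\<rho> (\<iota> (brkt Q X Y)) v =
        \<rho> (\<iota> X) (\<rho> (\<iota> Y) v) - scaleH H ((-1) ^ (p * q)) (\<rho> (\<iota> Y) (\<rho> (\<iota> X) v))"
      if "X \<in> homog Q p" "Y \<in> homog Q q" "v \<in> vecs H" for p q X Y v
    proof -
      have "X \<in> vecs Q" "Y \<in> vecs Q" using that homog_vecs[OF Q] by blast+
      then have "\<rho> (brkt E (\<iota> X) (\<iota> Y)) v = \<rho> (\<iota> (brkt Q X Y)) v"
        using eq[OF br \<iota>v[OF QB] that(3)] by blast
      then show ?thesis using rho_brkt[OF \<iota>(2)[OF that(1)] \<iota>(2)[OF that(2)] that(3)] by simp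
    qed
    show "innerH H (\<rho> (\<iota> X) u) v = innerH H u (scaleH H (- (\<i> ^ p)) (\<rho> (\<iota> X) v))"
      if "p < 2" "X \<in> homog Q p" "u \<in> vecs H" "v \<in> vecs H" for p X u v
      by (rule rho_adjoint[OF \<iota>(2)[OF that(2)] that(1,3,4)])
  qed
  moreover have "\<rho> X v = \<rho> (\<iota> (\<pi> X)) v" if "X \<in> vecs E" "v \<in> vecs H" for X v
    using eq[OF ker[OF that(1)] \<iota>v that(2)] \<pi> that(1) by blast
  ultimately show ?thesis unfolding factors_via_def by (intro exI[of _ "\<lambda>z. \<rho> (\<iota> z)"]) blast
qed

theorem theorem4p10:
  fixes k :: "'k::euclidean_space superalgebra"
    and g :: "('k ^ ('s::{finite,linorder} set)) superalgebra"
    and M :: "'m::euclidean_space superspace"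
    and \<omega> :: "'k ^ ('s set) \<Rightarrow> 'k ^ ('s set) \<Rightarrow> 'm"
    and ghat :: "(('k ^ ('s set)) \<times> 'm) superalgebra"
  assumes "lie_superalgebra k" and "compact_lsa k" and "simple_lsa k" and "odd_part k \<noteq> {0}"
    and "g = current k"
    and "superspace M" and "two_cocycle g M \<omega>"
    and "ghat = central_ext g M \<omega>" and "perfect_lsa ghat"
  shows "(urad ghat \<noteq> vecs ghat \<longrightarrow>
            (\<exists>\<sigma>. ext_section g M \<omega> \<sigma> \<and>
               is_direct_sum (urad ghat) (\<sigma> ` current_plus k) (central_part M \<inter> urad ghat)))
       \<and> ((\<forall>(H :: 'h::ab_group_add prehilbert) \<rho>. unitary_rep ghat H \<rho> \<longrightarrow> trivial_rep ghat H \<rho>)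
          \<or> (\<exists>(N :: 'm superspace) \<eta> \<pi>.
               superspace N \<and> two_cocycle k N \<eta> \<and>
               lsa_hom ghat (central_ext k N \<eta>) \<pi> \<and> \<pi> ` vecs ghat = vecs (central_ext k N \<eta>) \<and>
               (\<forall>(H :: 'h prehilbert) \<rho>. unitary_rep ghat H \<rho> \<longrightarrow>
                  factors_via ghat (central_ext k N \<eta>) \<pi> H \<rho>)))"
proof -
  interpret X: current_extension k M \<omega>
    using assms(1,3,4,6,7) unfolding assms(5)
    by (simp add: current_extension_def current_extension_axioms_def simple_lie_superalgebra_def)
  have gh: "ghat = central_ext (current k) M \<omega>" using assms(5,8) by simp
  have perfect: "perfect_lsa X.ghat" using assms(9) unfolding gh .
  show ?thesis
  proof (cases "urad ghat = vecs ghat")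
    case True
    have "trivial_rep ghat H \<rho>" if "unitary_rep ghat H \<rho>" for H :: "'h prehilbert" and \<rho>
    proof -
      interpret unitary_representation ghat H \<rho>
        using X.ext.super_skew_algebra_axioms that unfolding gh
        by (simp add: unitary_representation_def unitary_representation_axioms_def)
      show ?thesis using urad_subset_rep_kernel unfolding True by (auto simp: trivial_rep_def rep_kernel_def)
    qed
    then show ?thesis using True by blast
  next
    case False
    then have fst: "fst ` urad X.ghat = current_plus k" using X.fst_urad[OF perfect] unfolding gh by blast
    obtain N :: "'m superspace" and \<eta> \<pi> \<iota>
      where q: "superspace N" "two_cocycle k N \<eta>" "lsa_hom X.ghat (central_ext k N \<eta>) \<pi>"
        "\<pi> ` vecs X.ghat = vecs (central_ext k N \<eta>)"
        "linear \<iota>" "\<And>p z. z \<in> homog (central_ext k N \<eta>) p \<Longrightarrow> \<iota> z \<in> homog X.ghat p"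
        "\<And>x y. x \<in> vecs (central_ext k N \<eta>) \<Longrightarrow> y \<in> vecs (central_ext k N \<eta>) \<Longrightarrow>
            brkt X.ghat (\<iota> x) (\<iota> y) - \<iota> (brkt (central_ext k N \<eta>) x y) \<in> urad X.ghat"
        "\<And>X. X \<in> vecs X.ghat \<Longrightarrow> X - \<iota> (\<pi> X) \<in> urad X.ghat"
      using X.quotient_central_ext[OF X.ext.urad_ideal fst] by blast
    have "super_skew k N \<eta>" using q(2) unfolding two_cocycle_def by (rule conjunct1)
    then interpret Q: super_skew_algebra "central_ext k N \<eta>"
      by (rule central_ext_super_skew_algebra[OF X.super_skew_algebra_axioms q(1)])
    have "factors_via X.ghat (central_ext k N \<eta>) \<pi> H \<rho>" if "unitary_rep X.ghat H \<rho>"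
      for H :: "'h prehilbert" and \<rho>
      by (rule unitary_rep_descends[OF X.ext.super_skew_algebra_axioms Q.superspace that Q.brkt_vecs q(4-8)])
    then have "\<exists>(N :: 'm superspace) \<eta> \<pi>.
               superspace N \<and> two_cocycle k N \<eta> \<and>
               lsa_hom ghat (central_ext k N \<eta>) \<pi> \<and> \<pi> ` vecs ghat = vecs (central_ext k N \<eta>) \<and>
               (\<forall>(H :: 'h prehilbert) \<rho>. unitary_rep ghat H \<rho> \<longrightarrow>
                  factors_via ghat (central_ext k N \<eta>) \<pi> H \<rho>)"
      unfolding gh using q(1-4) by blast
    moreover have "\<exists>\<sigma>. ext_section g M \<omega> \<sigma> \<and>
        is_direct_sum (urad ghat) (\<sigma> ` current_plus k) (central_part M \<inter> urad ghat)"
      using X.direct_sum_section[OF X.ext.urad_ideal fst] unfolding gh assms(5) .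
    ultimately show ?thesis by blast
  qed
qed

end
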